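(* Let $(\mathcal{M},g)$ be a Riemannian manifold, let $S:\mathcal{M}\to\mathbb{R}$ be bounded from below, and let $\lambda>0$. Let $g_{ij}$ and $g^{ij}$ denote the local coordinates of the metric matrix function $G$ and of its inverse, respectively. For curves $\gamma:[0,1]\to\mathcal{M}$ with $\gamma(0)=a$ and $\gamma(1)=b$, consider the regularized energy $$\mathcal{E}_\lambda(\gamma)=\frac12\int_0^1\dot\gamma(t)^{\top}G(\gamma(t))\dot\gamma(t)\,\mathrm{d}t+\lambda\int_0^1 S(\gamma(t))\,\mathrm{d}t .$$ The first variation gives the following system of ordinary differential equations: $$\ddot\gamma^{k}(t)+\Gamma^{k}_{ij}\,\dot\gamma^{i}(t)\dot\gamma^{j}(t)=\frac{\lambda}{2}\,g^{kp}\,\partial_pS(\gamma(t)),$$ where $\Gamma^{k}_{ij}=\frac12 g^{kp}\left(\partial_i g_{pj}+\partial_j g_{pi}-\partial_p g_{ij}\right)$ denotes the Christoffel symbols of the Levi-Civita connection.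
   Context: Einstein summation over repeated indices is used, $\partial_p$ denotes the partial derivative with respect to the $p$-th local coordinate, and $g_{ij}$, $g^{kp}$, $\Gamma^k_{ij}$ are evaluated at $\gamma(t)$. The regularized energy is minimized over curves with fixed endpoints $a,b\in\mathcal{M}$.
   Formalization: The right-hand side is λ g^{kp} ∂_p S instead of the printed (λ/2) g^{kp} ∂_p S, which is false for the energy with the factor 1/2 (e.g. M=ℝ, g=1, S=x²/2, λ=1, γ=e^t). *)

theory Defs
  imports "HOL-Analysis.Analysis"
begin

section \<open>Regularity\<close>

text \<open>
  Class \<open>C\<^sup>k\<close>, one directional derivative at a time. Derivatives are taken within \<open>D\<close>, so that
  curves on the closed interval \<open>[0,1]\<close> are covered, with one-sided derivatives at the ends. The
  definition is only meant for sets in which derivatives within the set are unique. Those occurring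
  below are open sets and relatively open subsets of \<open>[0,1]\<close> and of \<open>(-e,e) \<times> [0,1]\<close>.
\<close>

fun Ck_on :: "nat \<Rightarrow> 'a::euclidean_space set \<Rightarrow> ('a \<Rightarrow> 'b::real_normed_vector) \<Rightarrow> bool" where
  "Ck_on 0 D f \<longleftrightarrow> continuous_on D f"
| "Ck_on (Suc k) D f \<longleftrightarrow>
     (\<exists>f'. (\<forall>x\<in>D. (f has_derivative f' x) (at x within D)) \<and> (\<forall>v. Ck_on k D (\<lambda>x. f' x v)))"

definition smooth_on :: "'a::euclidean_space set \<Rightarrow> ('a \<Rightarrow> 'b::real_normed_vector) \<Rightarrow> bool" where
  "smooth_on D f \<longleftrightarrow> (\<forall>k. Ck_on k D f)"

section \<open>Manifolds and metrics\<close>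

text \<open>
  The manifold is a second countable Hausdorff type \<open>'m\<close>. A chart is a pair of a domain \<open>U\<close> and a
  coordinate map \<open>\<phi>\<close>. The values of \<open>\<phi>\<close> outside \<open>U\<close> are irrelevant, and \<open>inv_into U \<phi>\<close> is the
  inverse of the chart.
\<close>

type_synonym ('m, 'n) chart = "'m set \<times> ('m \<Rightarrow> real ^ 'n)"

definition smooth_atlas ::
    "('m::{t2_space,second_countable_topology}, 'n::finite) chart set \<Rightarrow> bool" where
  "smooth_atlas A \<longleftrightarrow>
     (\<forall>(U,\<phi>)\<in>A. open U \<and> open (\<phi> ` U) \<and> homeomorphism U (\<phi> ` U) \<phi> (inv_into U \<phi>)) \<and>
     (\<Union>(U,\<phi>)\<in>A. U) = UNIV \<and>
     (\<forall>(U,\<phi>)\<in>A. \<forall>(V,\<psi>)\<in>A. smooth_on (\<phi> ` (U \<inter> V)) (\<psi> \<circ> inv_into U \<phi>))"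

text \<open>
  A Riemannian metric is given by its matrix function \<open>G (U,\<phi>)\<close> on the coordinate domain
  \<open>\<phi> ` U\<close> of every chart. The last clause is the transformation law of a covariant 2-tensor.
\<close>

definition riemannian_metric ::
    "('m::{t2_space,second_countable_topology}, 'n::finite) chart set
      \<Rightarrow> (('m, 'n) chart \<Rightarrow> real ^ 'n \<Rightarrow> real ^ 'n ^ 'n) \<Rightarrow> bool" where
  "riemannian_metric A G \<longleftrightarrow>
     (\<forall>(U,\<phi>)\<in>A. smooth_on (\<phi> ` U) (G (U,\<phi>)) \<and>
        (\<forall>x\<in>\<phi> ` U. transpose (G (U,\<phi>) x) = G (U,\<phi>) x \<and>
                    (\<forall>v. v \<noteq> 0 \<longrightarrow> 0 < v \<bullet> (G (U,\<phi>) x *v v)))) \<and>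
     (\<forall>(U,\<phi>)\<in>A. \<forall>(V,\<psi>)\<in>A. \<forall>x\<in>\<phi> ` (U \<inter> V).
        let \<tau> = \<psi> \<circ> inv_into U \<phi>; J = matrix (frechet_derivative \<tau> (at x))
        in G (U,\<phi>) x = transpose J ** G (V,\<psi>) (\<tau> x) ** J)"

definition Ck_function ::
    "nat \<Rightarrow> ('m::{t2_space,second_countable_topology}, 'n::finite) chart set
      \<Rightarrow> ('m \<Rightarrow> real) \<Rightarrow> bool" where
  "Ck_function k A S \<longleftrightarrow> (\<forall>(U,\<phi>)\<in>A. Ck_on k (\<phi> ` U) (S \<circ> inv_into U \<phi>))"

definition Ck_map_into ::
    "nat \<Rightarrow> ('m::{t2_space,second_countable_topology}, 'n::finite) chart set
      \<Rightarrow> 'a::euclidean_space set \<Rightarrow> ('a \<Rightarrow> 'm) \<Rightarrow> bool" where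
  "Ck_map_into k A D h \<longleftrightarrow>
     continuous_on D h \<and> (\<forall>(U,\<phi>)\<in>A. Ck_on k {x \<in> D. h x \<in> U} (\<phi> \<circ> h))"

section \<open>Expressions in local coordinates\<close>

definition partial :: "'n::finite \<Rightarrow> (real ^ 'n \<Rightarrow> real) \<Rightarrow> real ^ 'n \<Rightarrow> real" where
  "partial p f x = deriv (\<lambda>h. f (x + h *\<^sub>R axis p 1)) 0"

text \<open>The symbol \<open>christoffel g x k i j\<close> has the upper index \<open>k\<close> and the lower indices \<open>i\<close>, \<open>j\<close>.\<close>

definition christoffel ::
    "(real ^ 'n \<Rightarrow> real ^ 'n ^ 'n) \<Rightarrow> real ^ 'n \<Rightarrow> 'n::finite \<Rightarrow> 'n \<Rightarrow> 'n \<Rightarrow> real" where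
  "christoffel g x k i j =
     1/2 * (\<Sum>p\<in>UNIV. matrix_inv (g x) $ k $ p *
       (partial i (\<lambda>y. g y $ p $ j) x + partial j (\<lambda>y. g y $ p $ i) x
         - partial p (\<lambda>y. g y $ i $ j) x))"

definition velocity :: "(real \<Rightarrow> 'a::real_normed_vector) \<Rightarrow> real \<Rightarrow> 'a" where
  "velocity x t = vector_derivative x (at t within {0..1})"

definition acceleration :: "(real \<Rightarrow> 'a::real_normed_vector) \<Rightarrow> real \<Rightarrow> 'a" where
  "acceleration x t = velocity (velocity x) t"

section \<open>The regularized energy and its first variation\<close>

text \<open>
  The squared speed is computed in some chart around \<open>\<gamma> t\<close>. By the transformation law of the metric
  it does not depend on the choice.
\<close>

definition squared_speed ::
    "('m::{t2_space,second_countable_topology}, 'n::finite) chart set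
      \<Rightarrow> (('m, 'n) chart \<Rightarrow> real ^ 'n \<Rightarrow> real ^ 'n ^ 'n) \<Rightarrow> (real \<Rightarrow> 'm) \<Rightarrow> real \<Rightarrow> real" where
  "squared_speed A G \<gamma> t =
     (let (U,\<phi>) = (SOME c. c \<in> A \<and> \<gamma> t \<in> fst c); v = velocity (\<phi> \<circ> \<gamma>) t
      in v \<bullet> (G (U,\<phi>) (\<phi> (\<gamma> t)) *v v))"

definition reg_energy ::
    "('m::{t2_space,second_countable_topology}, 'n::finite) chart set
      \<Rightarrow> (('m, 'n) chart \<Rightarrow> real ^ 'n \<Rightarrow> real ^ 'n ^ 'n) \<Rightarrow> ('m \<Rightarrow> real) \<Rightarrow> real
      \<Rightarrow> (real \<Rightarrow> 'm) \<Rightarrow> real" where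
  "reg_energy A G S lam \<gamma> =
     1/2 * integral {0..1} (squared_speed A G \<gamma>) + lam * integral {0..1} (\<lambda>t. S (\<gamma> t))"

text \<open>
  With kinetic term \<open>1/2 * g(v,v)\<close>, the Euler-Lagrange equation has the right-hand side
  \<open>lam * grad S\<close>. The coefficient \<open>lam/2\<close>, as sometimes printed, belongs to the functional
  without the factor \<open>1/2\<close>, which is twice the energy with parameter \<open>lam/2\<close>.
\<close>

definition curves ::
    "('m::{t2_space,second_countable_topology}, 'n::finite) chart set \<Rightarrow> 'm \<Rightarrow> 'm
      \<Rightarrow> (real \<Rightarrow> 'm) set" where
  "curves A a b = {\<gamma>. Ck_map_into 2 A {0..1} \<gamma> \<and> \<gamma> 0 = a \<and> \<gamma> 1 = b}"

definition variation ::
    "('m::{t2_space,second_countable_topology}, 'n::finite) chart set \<Rightarrow> (real \<Rightarrow> 'm)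
      \<Rightarrow> (real \<Rightarrow> real \<Rightarrow> 'm) \<Rightarrow> bool" where
  "variation A \<gamma> H \<longleftrightarrow>
     (\<exists>e>0. Ck_map_into 2 A ({-e<..<e} \<times> {0..1}) (\<lambda>(s, t). H s t) \<and>
        (\<forall>t\<in>{0..1}. H 0 t = \<gamma> t) \<and>
        (\<forall>s\<in>{-e<..<e}. H s 0 = \<gamma> 0 \<and> H s 1 = \<gamma> 1))"

definition first_variation_vanishes ::
    "('m::{t2_space,second_countable_topology}, 'n::finite) chart set
      \<Rightarrow> ((real \<Rightarrow> 'm) \<Rightarrow> real) \<Rightarrow> (real \<Rightarrow> 'm) \<Rightarrow> bool" where
  "first_variation_vanishes A E \<gamma> \<longleftrightarrow>
     (\<forall>H. variation A \<gamma> H \<longrightarrow> ((\<lambda>s. E (H s)) has_real_derivative 0) (at 0))"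

end

theory Submission
  imports Defs
begin

text \<open>
  In a chart the energy has the Lagrangian \<open>L(q,v) = 1/2 * v \<bullet> g(q) v + lam * \<sigma>(q)\<close>. A curve is varied
  only over an interval \<open>{c..d}\<close> inside \<open>(0,1)\<close> that it maps into the chart, by moving its coordinates
  by \<open>s * \<eta>(t)\<close> in a fixed direction \<open>w\<close>, where \<open>\<eta>\<close> is a \<open>C\<^sup>2\<close> bump supported in \<open>{c..d}\<close>. Then only one
  chart enters the derivative of the energy, and the rest of the energy is constant in \<open>s\<close>.
  Differentiation under the integral and integration by parts give the derivative \<open>\<integral> \<eta> * P w\<close> with the
  Euler-Lagrange expression \<open>P w\<close>, which is therefore zero. By continuity of \<open>P w\<close> it suffices to use such
  intervals arbitrarily close to a given time, which covers the end times \<open>0\<close> and \<open>1\<close> as well. The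
  geodesic form follows by inverting the metric matrix.
\<close>

text \<open>\<open>squared_speed\<close> reads the velocity in a chart picked by choice separately
  at each time. Until the transformation law shows that every chart gives the same value, neither
  continuity in \<open>t\<close> nor a formula in the working chart is available.

  The varied curves have to be of class C2 in every chart of the atlas, not only in the one where
  they are moved. The conditions \<open>0 < c\<close> and \<open>d < 1\<close> serve this: the chart
  formula then holds on an open set of times around \<open>{c..d}\<close>, the curve stays put on
  the open complement of \<open>{c..d}\<close>, and the end values are fixed automatically. Gluing
  the two pieces requires unique derivatives, which at the boundary of the strip has to be checked
  by hand.

  \<open>Ck_on\<close> controls derivatives in fixed directions only, whereas the chain rule and the
  Euler-Lagrange expression differentiate in directions that move; expansion in a basis bridges the
  gap.

  The same family of curves serves both forms of criticality: its members are competitors for a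
  minimizer, and the family is an admissible variation. In either case the derivative of the energy
  exists by computation, and it must be zero.\<close>

section \<open>Calculus of \<open>C\<^sup>k\<close> functions\<close>

lemma Ck_on_cong:
  assumes "\<And>x. x \<in> D \<Longrightarrow> f x = g x"
  shows "Ck_on k D f \<longleftrightarrow> Ck_on k D g"
proof (cases k)
  case 0
  then show ?thesis using assms by (simp cong: continuous_on_cong)
next
  case (Suc j)
  have "(f has_derivative f') (at x within D) \<longleftrightarrow> (g has_derivative f') (at x within D)"
    if "x \<in> D" for x f'
    using that assms has_derivative_transform by metis
  then show ?thesis by (simp add: Suc)
qed

lemma Ck_on_SucE:
  assumes "Ck_on (Suc k) D f"
  obtains f' where "\<And>x. x \<in> D \<Longrightarrow> (f has_derivative f' x) (at x within D)"
    and "\<And>v. Ck_on k D (\<lambda>x. f' x v)"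
  using assms by auto

lemma at_within_Int_open:
  assumes "x \<in> D" "x \<in> N" "open N"
  shows "at x within (D \<inter> N) = at x within D"
  by (rule at_within_nhd[of x N]) (use assms in auto)

lemma Ck_on_subset:
  assumes "Ck_on k D f" "E \<subseteq> D"
  shows "Ck_on k E f"
  using assms
proof (induction k arbitrary: f)
  case 0
  then show ?case by (simp add: continuous_on_subset)
next
  case (Suc k)
  then show ?case
    by (simp only: Ck_on.simps) (metis has_derivative_subset subsetD)
qed

lemma Ck_on_SucD: "Ck_on (Suc k) D f \<Longrightarrow> Ck_on k D f"
proof (induction k arbitrary: f)
  case 0
  then show ?case
    using has_derivative_continuous by (fastforce simp: continuous_on_eq_continuous_within)
next
  case (Suc k)
  then show ?case by (metis Ck_on.simps(2))
qed

lemma Ck_on_antimono: "Ck_on m D f \<Longrightarrow> k \<le> m \<Longrightarrow> Ck_on k D f"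
  by (induction m) (use Ck_on_SucD le_Suc_eq in \<open>metis le_zero_eq\<close>)+

lemma Ck_on_imp_continuous_on: "Ck_on k D f \<Longrightarrow> continuous_on D f"
  using Ck_on_antimono[of k D f 0] by simp

lemma Ck_on_const: "Ck_on k D (\<lambda>x. c)"
proof (induction k arbitrary: c)
  case (Suc k)
  show ?case
    unfolding Ck_on.simps by (rule exI[of _ "\<lambda>x v. 0"]) (simp add: Suc)
qed simp

lemma Ck_on_affine:
  assumes "bounded_linear L"
  shows "Ck_on k D (\<lambda>x. c + L x)"
proof (cases k)
  case 0
  then show ?thesis
    using assms by (simp add: continuous_on_add linear_continuous_on)
next
  case (Suc j)
  have "((\<lambda>x. c + L x) has_derivative L) (at x within D)" for x
    using bounded_linear_imp_has_derivative[OF assms] by (auto intro!: derivative_eq_intros)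
  then show ?thesis
    unfolding Suc Ck_on.simps by (intro exI[of _ "\<lambda>x. L"]) (simp add: Ck_on_const)
qed

lemmas Ck_on_linear = Ck_on_affine[where c = 0, simplified]

lemma Ck_on_add:
  assumes "Ck_on k D f" "Ck_on k D g"
  shows "Ck_on k D (\<lambda>x. f x + g x)"
  using assms
proof (induction k arbitrary: f g)
  case 0
  then show ?case by (simp add: continuous_on_add)
next
  case (Suc k)
  from Suc.prems obtain f' g' where
    "\<And>x. x \<in> D \<Longrightarrow> (f has_derivative f' x) (at x within D)" "\<And>v. Ck_on k D (\<lambda>x. f' x v)"
    "\<And>x. x \<in> D \<Longrightarrow> (g has_derivative g' x) (at x within D)" "\<And>v. Ck_on k D (\<lambda>x. g' x v)"
    by (elim Ck_on_SucE) blast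
  then show ?case
    unfolding Ck_on.simps
    by (intro exI[of _ "\<lambda>x v. f' x v + g' x v"]) (auto intro!: Suc.IH has_derivative_add)
qed

lemma Ck_on_sum:
  assumes "\<And>i. i \<in> I \<Longrightarrow> Ck_on k D (f i)"
  shows "Ck_on k D (\<lambda>x. \<Sum>i\<in>I. f i x)"
  using assms by (induction I rule: infinite_finite_induct) (auto intro!: Ck_on_add Ck_on_const)

text \<open>The product rule leaves \<open>c\<close> and \<open>f\<close> themselves beside a
  derivative, so the induction hypothesis is applied to factors whose order is first lowered by
  \<open>Ck_on_SucD\<close>.\<close>

lemma Ck_on_scaleR:
  assumes "Ck_on k D c" "Ck_on k D f"
  shows "Ck_on k D (\<lambda>x. c x *\<^sub>R f x)"
  using assms
proof (induction k arbitrary: c f)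
  case 0
  then show ?case by (simp add: continuous_on_scaleR)
next
  case (Suc k)
  from Suc.prems obtain c' f' where
    "\<And>x. x \<in> D \<Longrightarrow> (c has_derivative c' x) (at x within D)" "\<And>v. Ck_on k D (\<lambda>x. c' x v)"
    "\<And>x. x \<in> D \<Longrightarrow> (f has_derivative f' x) (at x within D)" "\<And>v. Ck_on k D (\<lambda>x. f' x v)"
    by (elim Ck_on_SucE) blast
  then show ?case
    unfolding Ck_on.simps
    by (intro exI[of _ "\<lambda>x v. c x *\<^sub>R f' x v + c' x v *\<^sub>R f x"])
       (auto intro!: Suc.IH has_derivative_scaleR Ck_on_add Suc.prems[THEN Ck_on_SucD])
qed

lemma Ck_on_bounded_linear:
  assumes "bounded_linear L" "Ck_on k D f"
  shows "Ck_on k D (\<lambda>x. L (f x))"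
  using assms(2)
proof (induction k arbitrary: f)
  case 0
  then show ?case using assms(1) by (simp add: linear_continuous_on_compose bounded_linear.continuous_on)
next
  case (Suc k)
  from Suc.prems obtain f' where
    "\<And>x. x \<in> D \<Longrightarrow> (f has_derivative f' x) (at x within D)" "\<And>v. Ck_on k D (\<lambda>x. f' x v)"
    by auto
  then show ?case
    unfolding Ck_on.simps
    by (intro exI[of _ "\<lambda>x v. L (f' x v)"])
       (auto intro!: Suc.IH bounded_linear.has_derivative[OF assms(1)])
qed

text \<open>Applied to derivatives: it trades a direction depending on the point for fixed basis
  directions with scalar coefficients, the only kind of direction for which \<open>Ck_on\<close>
  gives regularity.\<close>

lemma linear_eq_sum_Basis:
  fixes L :: "'a::euclidean_space \<Rightarrow> 'b::real_vector"
  assumes "linear L"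
  shows "L v = (\<Sum>i\<in>Basis. (v \<bullet> i) *\<^sub>R L i)"
proof -
  have "L v = L (\<Sum>i\<in>Basis. (v \<bullet> i) *\<^sub>R i)" by (simp add: euclidean_representation)
  then show ?thesis by (simp add: linear_sum[OF assms] linear_scale[OF assms])
qed

lemma Ck_on_compose:
  assumes "Ck_on k E g" "Ck_on k D f" "f ` D \<subseteq> E"
  shows "Ck_on k D (\<lambda>x. g (f x))"
  using assms(1,2)
proof (induction k arbitrary: g)
  case 0
  then show ?case using assms(3) by (auto intro: continuous_on_compose2)
next
  case (Suc k)
  from Suc.prems obtain f' g' where
    f': "\<And>x. x \<in> D \<Longrightarrow> (f has_derivative f' x) (at x within D)" "\<And>v. Ck_on k D (\<lambda>x. f' x v)" and
    g': "\<And>x. x \<in> E \<Longrightarrow> (g has_derivative g' x) (at x within E)" "\<And>v. Ck_on k E (\<lambda>x. g' x v)"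
    by (elim Ck_on_SucE) blast
  have deriv: "((\<lambda>x. g (f x)) has_derivative (\<lambda>v. g' (f x) (f' x v))) (at x within D)"
    if "x \<in> D" for x
  proof -
    have "f x \<in> E" using that assms(3) by auto
    then show ?thesis
      using has_derivative_in_compose[OF f'(1)[OF that]] has_derivative_subset[OF g'(1) assms(3)]
      by blast
  qed
  \<comment> \<open>The direction \<open>f' x v\<close> of the outer derivative moves with
    \<open>x\<close>, so \<open>g'(2)\<close> does not apply to it directly.\<close>
  have "Ck_on k D (\<lambda>x. g' (f x) (f' x v))" for v
  proof -
    have "g' (f x) (f' x v) = (\<Sum>i\<in>Basis. (f' x v \<bullet> i) *\<^sub>R g' (f x) i)" if "x \<in> D" for x
      using g'(1)[of "f x"] that assms(3)
      by (intro linear_eq_sum_Basis) (auto dest: has_derivative_linear)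
    moreover have "Ck_on k D (\<lambda>x. \<Sum>i\<in>Basis. (f' x v \<bullet> i) *\<^sub>R g' (f x) i)"
      by (intro Ck_on_sum Ck_on_scaleR Suc.IH g'(2) Ck_on_SucD[OF Suc.prems(2)]
          Ck_on_bounded_linear[OF bounded_linear_inner_left] f'(2))
    ultimately show ?thesis by (simp cong: Ck_on_cong)
  qed
  with deriv show ?case
    unfolding Ck_on.simps by (intro exI[of _ "\<lambda>x v. g' (f x) (f' x v)"]) blast
qed

text \<open>Derivatives chosen on different neighbourhoods could disagree where these overlap. The
  first assumption lets \<open>D\<close> accumulate at each of its points along every coordinate
  axis, which makes the derivative within \<open>D\<close> unique and the local choices
  compatible.\<close>

lemma Ck_on_local:
  assumes unique: "\<And>x i e. x \<in> D \<Longrightarrow> i \<in> Basis \<Longrightarrow> e > 0 \<Longrightarrow> \<exists>d. 0 < \<bar>d\<bar> \<and> \<bar>d\<bar> < e \<and> x + d *\<^sub>R i \<in> D"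
    and "\<And>x. x \<in> D \<Longrightarrow> \<exists>N. open N \<and> x \<in> N \<and> Ck_on k (D \<inter> N) f"
  shows "Ck_on k D f"
  using assms(2)
proof (induction k arbitrary: f)
  case 0
  then show ?case
    by (simp add: continuous_on_eq_continuous_within) (metis IntI at_within_Int_open continuous_within)
next
  case (Suc k)
  \<comment> \<open>A single global choice of derivative, fixed before any neighbourhood is;
    uniqueness identifies it with each local \<open>g'\<close>.\<close>
  define f' where "f' = (\<lambda>x. frechet_derivative f (at x within D))"
  have local: "\<exists>N g'. open N \<and> x \<in> N \<and> (\<forall>y\<in>D \<inter> N. (f has_derivative g' y) (at y within D))
      \<and> (\<forall>v. Ck_on k (D \<inter> N) (\<lambda>y. g' y v))" if "x \<in> D" for x
    using Suc.prems[OF that] by (simp only: Ck_on.simps) (metis IntE at_within_Int_open)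
  have deriv: "(f has_derivative f' x) (at x within D)" if "x \<in> D" for x
    using local[OF that] that unfolding f'_def
    by (metis IntI differentiable_def frechet_derivative_works)
  have "Ck_on k D (\<lambda>x. f' x v)" for v
  proof (rule Suc.IH)
    fix x assume "x \<in> D"
    from local[OF this] obtain N g' where N: "open N" "x \<in> N"
      "\<And>y. y \<in> D \<inter> N \<Longrightarrow> (f has_derivative g' y) (at y within D)" "Ck_on k (D \<inter> N) (\<lambda>y. g' y v)"
      by blast
    have "g' y = f' y" if "y \<in> D \<inter> N" for y
        using frechet_derivative_unique_within[OF N(3)[OF that] deriv] unique that by blast
    with N(4) have "Ck_on k (D \<inter> N) (\<lambda>y. f' y v)" using Ck_on_cong[of "D \<inter> N" "\<lambda>y. g' y v" "\<lambda>y. f' y v"] by simp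
    with N(1,2) show "\<exists>N. open N \<and> x \<in> N \<and> Ck_on k (D \<inter> N) (\<lambda>x. f' x v)" by blast
  qed
  with deriv show ?case unfolding Ck_on.simps by blast
qed

section \<open>Curves and bump functions\<close>

lemma velocity_eq:
  fixes x :: "real \<Rightarrow> 'a::real_normed_vector"
  assumes "(x has_vector_derivative v) (at t within {0..1})" "t \<in> {0..1}"
  shows "velocity x t = v"
  unfolding velocity_def
  using vector_derivative_within_cbox[of 0 1 t x v] assms by simp

text \<open>The two functions have the same derivatives at \<open>t\<close> in the sense of the
  predicate, hence \<open>vector_derivative\<close> picks the same value for both, even where no
  derivative exists.\<close>

lemma velocity_cong_open:
  assumes "open N" "t \<in> N" "t \<in> {0..1}" "\<And>s. s \<in> N \<inter> {0..1} \<Longrightarrow> x s = y s"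
  shows "velocity x t = velocity y t"
proof -
  have "(x has_vector_derivative v) (at t within {0..1}) \<longleftrightarrow>
        (y has_vector_derivative v) (at t within {0..1})" for v
    unfolding has_vector_derivative_def
      at_within_Int_open[OF assms(3,2,1), symmetric]
    using assms(2,3,4) has_derivative_transform[of t "{0..1} \<inter> N" x y]
      has_derivative_transform[of t "{0..1} \<inter> N" y x] by (auto simp: Int_commute)
  then show ?thesis unfolding velocity_def vector_derivative_def by simp
qed

text \<open>\<open>Ck_on\<close> speaks of derivatives within \<open>D\<close>,
  \<open>velocity\<close> of derivatives within \<open>{0..1}\<close>. The two filters agree at
  points of \<open>D\<close> because \<open>D\<close> is relatively open.\<close>

lemma C2_curve:
  fixes x :: "real \<Rightarrow> 'a::real_normed_vector"
  assumes "Ck_on 2 D x" "D = {0..1} \<inter> N" "open N"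
  shows "\<And>t. t \<in> D \<Longrightarrow> (x has_vector_derivative velocity x t) (at t within {0..1})"
    and "\<And>t. t \<in> D \<Longrightarrow> (velocity x has_vector_derivative acceleration x t) (at t within {0..1})"
    and "continuous_on D (velocity x)" and "continuous_on D (acceleration x)"
proof -
  have within: "at t within D = at t within {0..1}" if "t \<in> D" for t
    using at_within_Int_open[of t "{0..1}" N] that assms(2,3) by simp
  have derivs: "(\<forall>t\<in>D. (f has_vector_derivative velocity f t) (at t within {0..1})) \<and>
      Ck_on k D (velocity f)"
    if f: "Ck_on (Suc k) D f" for k and f :: "real \<Rightarrow> 'a"
  proof -
    obtain f' where f': "\<And>t. t \<in> D \<Longrightarrow> (f has_derivative f' t) (at t within D)"
      "\<And>v. Ck_on k D (\<lambda>t. f' t v)"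
      using f by (elim Ck_on_SucE) blast
    have "(f has_vector_derivative f' t 1) (at t within {0..1})" if "t \<in> D" for t
    proof -
      have "f' t h = h *\<^sub>R f' t 1" for h
        using linear_scale[OF has_derivative_linear[OF f'(1)[OF that]], of h 1] by simp
      then have "f' t = (\<lambda>h. h *\<^sub>R f' t 1)" by (rule ext)
      then show ?thesis
        using f'(1)[OF that] within[OF that] unfolding has_vector_derivative_def by metis
    qed
    note deriv = this
    then have eq: "velocity f t = f' t 1" if "t \<in> D" for t
      by (rule velocity_eq) (use that assms(2) in auto)
    have "Ck_on k D (velocity f)"
      by (rule Ck_on_cong[THEN iffD2, OF eq f'(2)])
    then show ?thesis using deriv eq by simp
  qed
  have "Ck_on (Suc (Suc 0)) D x" using assms(1) by (simp only: numeral_2_eq_2)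
  note x = derivs[OF this]
  note v' = derivs[OF conjunct2[OF x]]
  have acc: "acceleration x = velocity (velocity x)" by (simp add: acceleration_def fun_eq_iff)
  show "\<And>t. t \<in> D \<Longrightarrow> (x has_vector_derivative velocity x t) (at t within {0..1})"
    using x by blast
  show "\<And>t. t \<in> D \<Longrightarrow> (velocity x has_vector_derivative acceleration x t) (at t within {0..1})"
    unfolding acc using v' by blast
  show "continuous_on D (velocity x)" "continuous_on D (acceleration x)"
    unfolding acc using x v' by (blast intro: Ck_on_imp_continuous_on)+
qed

text \<open>Away from \<open>0\<close> the function is locally a power or zero. At \<open>0\<close>
  one factor \<open>u\<close> splits off, and the remaining continuous factor
  \<open>max 0 u ^ (n + 1)\<close> serves as slope in Caratheodory's criterion.\<close>

lemma DERIV_pos_part_power: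
  fixes u :: real
  shows "((\<lambda>u. max 0 u ^ (n + 2)) has_real_derivative (real (n + 2) * max 0 u ^ (n + 1))) (at u)"
proof -
  consider "u > 0" | "u < 0" | "u = 0" by linarith
  then show ?thesis
  proof cases
    case 1
    have "((\<lambda>u. u ^ (n + 2)) has_real_derivative (real (n + 2) * max 0 u ^ (n + 1))) (at u)"
      using 1 DERIV_pow[of "n + 2" u UNIV] by simp
    then show ?thesis
      by (rule DERIV_cong_ev[THEN iffD1, OF refl _ refl, rotated])
        (use 1 eventually_at_topological[of "\<lambda>u. u ^ (n+2) = max 0 u ^ (n+2)" u UNIV]
          in \<open>auto simp: eventually_nhds intro!: exI[of _ "{0<..}"]\<close>)
  next
    case 2
    have "((\<lambda>u. 0) has_real_derivative (real (n + 2) * max 0 u ^ (n + 1))) (at u)"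
      using 2 by auto
    then show ?thesis
      by (rule DERIV_cong_ev[THEN iffD1, OF refl _ refl, rotated])
        (use 2 in \<open>auto simp: eventually_nhds intro!: exI[of _ "{..<0}"]\<close>)
  next
    case 3
    have "isCont (\<lambda>u::real. max 0 u ^ (n + 1)) 0" by (intro continuous_intros)
    moreover have "max 0 u ^ (n + 2) = max 0 u ^ (n + 1) * u" for u :: real
      by (cases "u \<le> 0") auto
    ultimately show ?thesis
      unfolding CARAT_DERIV by (intro exI[of _ "\<lambda>u. max 0 u ^ (n + 1)"]) (simp add: 3)
  qed
qed

text \<open>For \<open>c < d\<close> the product is positive exactly between \<open>c\<close> and
  \<open>d\<close>, with simple zeros there. Each derivative costs one power of the positive part,
  so \<open>3\<close> is the least integer exponent for which the second derivative is still
  continuous.\<close>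

definition bump :: "real \<Rightarrow> real \<Rightarrow> real \<Rightarrow> real" where
  "bump c d t = max 0 ((t - c) * (d - t)) ^ 3"

definition bump' :: "real \<Rightarrow> real \<Rightarrow> real \<Rightarrow> real" where
  "bump' c d t = 3 * max 0 ((t - c) * (d - t)) ^ 2 * (c + d - 2 * t)"

definition bump'' :: "real \<Rightarrow> real \<Rightarrow> real \<Rightarrow> real" where
  "bump'' c d t = 6 * max 0 ((t - c) * (d - t)) * (c + d - 2 * t)\<^sup>2
     - 6 * max 0 ((t - c) * (d - t)) ^ 2"

lemma DERIV_bump: "(bump c d has_real_derivative bump' c d t) (at t)"
proof -
  have "((\<lambda>t. (t - c) * (d - t)) has_real_derivative (c + d - 2 * t)) (at t)"
    by (auto intro!: derivative_eq_intros)
  from DERIV_chain2[OF DERIV_pos_part_power[of 1] this] show ?thesis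
    by (simp add: bump_def[abs_def] bump'_def eval_nat_numeral)
qed

lemma DERIV_bump': "(bump' c d has_real_derivative bump'' c d t) (at t)"
proof -
  have "((\<lambda>t. (t - c) * (d - t)) has_real_derivative (c + d - 2 * t)) (at t)"
    by (auto intro!: derivative_eq_intros)
  from DERIV_chain2[OF DERIV_pos_part_power[of 0] this]
  have *: "((\<lambda>t. (max 0 ((t - c) * (d - t)))\<^sup>2) has_real_derivative
      2 * max 0 ((t - c) * (d - t)) * (c + d - 2 * t)) (at t)"
    by (simp add: eval_nat_numeral)
  have "((\<lambda>t. c + d - 2 * t) has_real_derivative - 2) (at t)"
    by (auto intro!: derivative_eq_intros)
  from DERIV_mult[OF DERIV_cmult[OF *, of 3] this] show ?thesis
    by (simp add: bump'_def[abs_def] bump''_def power2_eq_square mult.assoc)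
qed

lemma Ck_on_Suc_real:
  assumes "\<And>t. t \<in> D \<Longrightarrow> (f has_real_derivative f' t) (at t within D)" "Ck_on k D f'"
  shows "Ck_on (Suc k) D f"
proof -
  have "Ck_on k D (\<lambda>t. f' t * v)" for v
    using Ck_on_scaleR[OF assms(2) Ck_on_const[of k D v]] by simp
  then show ?thesis
    unfolding Ck_on.simps using assms(1)
    by (intro exI[of _ "\<lambda>t v. f' t * v"]) (auto simp: has_field_derivative_def)
qed

lemma C2_bump: "Ck_on 2 D (bump c d)"
proof -
  have "Ck_on 0 D (bump'' c d)"
    unfolding bump''_def[abs_def] by (auto intro!: continuous_intros)
  then show ?thesis
    unfolding numeral_2_eq_2
    by (blast intro: Ck_on_Suc_real has_field_derivative_at_within DERIV_bump DERIV_bump')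
qed

lemma bump_eq_0:
  assumes "c \<le> d" "t \<notin> {c<..<d}"
  shows "bump c d t = 0"
proof -
  have "(t - c) * (d - t) \<le> 0"
    using assms by (cases "t \<le> c") (auto simp: mult_le_0_iff)
  then show ?thesis by (simp add: bump_def)
qed

lemma bump_pos: "t \<in> {c<..<d} \<Longrightarrow> bump c d t > 0"
  by (simp add: bump_def)

lemma bump_nonneg: "bump c d t \<ge> 0"
  by (simp add: bump_def)

lemma continuous_on_bump: "continuous_on D (bump c d)"
  by (auto simp: bump_def[abs_def] intro!: continuous_intros)

lemma continuous_on_bump': "continuous_on D (bump' c d)"
  by (auto simp: bump'_def[abs_def] intro!: continuous_intros)

text \<open>
  No admissible interval contains \<open>t\<^sub>0\<close> when \<open>t\<^sub>0\<close> is \<open>0\<close> or \<open>1\<close>. Continuity of \<open>P\<close> still forces a fixed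
  sign on nearby intervals.
\<close>

lemma fundamental_lemma_bump:
  fixes P :: "real \<Rightarrow> real"
  assumes cont: "continuous_on D P" and D: "D = {0..1} \<inter> N" "open N" and "t\<^sub>0 \<in> D"
    and zero: "\<And>c d. 0 < c \<Longrightarrow> c < d \<Longrightarrow> d < 1 \<Longrightarrow> {c..d} \<subseteq> D \<Longrightarrow>
      integral {c..d} (\<lambda>t. bump c d t * P t) = 0"
  shows "P t\<^sub>0 = 0"
proof -
  \<comment> \<open>Stated for a fresh \<open>P\<close> in order to be used for the given function
    and for its negative.\<close>
  have "\<not> P t\<^sub>0 > 0" if P: "continuous_on D P" and
    zero: "\<And>c d. 0 < c \<Longrightarrow> c < d \<Longrightarrow> d < 1 \<Longrightarrow> {c..d} \<subseteq> D \<Longrightarrow>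
      integral {c..d} (\<lambda>t. bump c d t * P t) = 0" for P
  proof
    assume pos: "P t\<^sub>0 > 0"
    obtain r where r: "r > 0" "\<And>t. t \<in> D \<Longrightarrow> dist t t\<^sub>0 < r \<Longrightarrow> dist (P t) (P t\<^sub>0) < P t\<^sub>0"
      using P \<open>t\<^sub>0 \<in> D\<close> pos unfolding continuous_on_iff by metis
    obtain s where s: "s > 0" "ball t\<^sub>0 s \<subseteq> N"
      using D \<open>t\<^sub>0 \<in> D\<close> openE by blast
    \<comment> \<open>The interval of radius \<open>q/2\<close> about \<open>t\<^sub>0\<close> is
      clipped to \<open>{q/4..1 - q/4}\<close>. Since \<open>q \<le> 1\<close>, something of
      positive length is left even if \<open>t\<^sub>0\<close> is \<open>0\<close> or
      \<open>1\<close>, and all of it lies within \<open>q\<close> of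
      \<open>t\<^sub>0\<close>.\<close>
    define q where "q = min (min r s) 1"
    define c where "c = max (t\<^sub>0 - q/2) (q/4)"
    define d where "d = min (t\<^sub>0 + q/2) (1 - q/4)"
    have q: "0 < q" "q \<le> r" "q \<le> s" "q \<le> 1" using r s by (auto simp: q_def)
    have t: "0 \<le> t\<^sub>0" "t\<^sub>0 \<le> 1" using \<open>t\<^sub>0 \<in> D\<close> D by auto
    have cd: "0 < c" "c < d" "d < 1" using q t by (auto simp: c_def d_def)
    have near: "dist t t\<^sub>0 < q" if "t \<in> {c..d}" for t
      using that q by (auto simp: c_def d_def dist_real_def)
    have sub: "{c..d} \<subseteq> D"
    proof
      fix t assume "t \<in> {c..d}"
      then show "t \<in> D" using near[of t] cd q s D by (auto simp: dist_commute subset_iff)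
    qed
    have Ppos: "P t > 0" if "t \<in> {c..d}" for t
      using r(2)[of t] near[OF that] q sub that by (fastforce simp: dist_real_def)
    have "continuous_on {c..d} (\<lambda>t. bump c d t * P t)"
      by (intro continuous_on_mult continuous_on_bump continuous_on_subset[OF P sub])
    then have "\<forall>t\<in>{c..d}. bump c d t * P t = 0"
      using integral_eq_0_iff[of c d "\<lambda>t. bump c d t * P t"] cd(2) zero[OF cd sub] Ppos
      by (simp add: bump_nonneg less_imp_le)
    then have "bump c d ((c+d)/2) * P ((c+d)/2) = 0" using cd by auto
    then show False
      using bump_pos[of "(c+d)/2" c d] Ppos[of "(c+d)/2"] cd by auto
  qed
  note key = this
  have "integral {c..d} (\<lambda>t. bump c d t * - P t) = 0"
    if "0 < c" "c < d" "d < 1" "{c..d} \<subseteq> D" for c d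
    using zero[OF that] by simp
  then show ?thesis
    using key[OF cont zero] key[of "\<lambda>t. - P t", OF continuous_on_minus[OF cont]] by fastforce
qed

text \<open>This supplies the uniqueness assumption of \<open>Ck_on_local\<close> for a strip whose
  second factor is closed.\<close>

lemma unique_derivatives_rel_open_strip:
  fixes x :: "real \<times> real"
  assumes D: "D = ({-e<..<e} \<times> {0..1}) \<inter> N" "open N" and "x \<in> D" "i \<in> Basis" "r > 0"
  shows "\<exists>d. 0 < \<bar>d\<bar> \<and> \<bar>d\<bar> < r \<and> x + d *\<^sub>R i \<in> D"
proof -
  have "open (({-e<..<e} \<times> UNIV) \<inter> N)" using D by (intro open_Int open_Times) auto
  then obtain q where q: "q > 0" "ball x q \<subseteq> ({-e<..<e} \<times> UNIV) \<inter> N"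
    using assms openE[of "({-e<..<e} \<times> UNIV) \<inter> N" x] by auto
  define p where "p = min (min (q/2) (r/2)) (1/2)"
  have p: "0 < p" "p < q" "p < r" "p \<le> 1/2" using q assms by (auto simp: p_def)
  \<comment> \<open>The step points towards the middle of \<open>{0..1}\<close>; as its length is at
    most \<open>1/2\<close>, the second coordinate cannot leave that interval.\<close>
  define d where "d = (if snd x \<le> 1/2 then p else - p)"
  have "dist x (x + d *\<^sub>R i) < q"
    using p \<open>i \<in> Basis\<close> by (simp add: dist_norm d_def)
  then have "x + d *\<^sub>R i \<in> ({-e<..<e} \<times> UNIV) \<inter> N" using q by auto
  moreover have "snd (x + d *\<^sub>R i) \<in> {0..1}"
    using assms(1,3,4) p by (auto simp: Basis_prod_def d_def)
  ultimately have "x + d *\<^sub>R i \<in> D" using D by (auto simp: mem_Times_iff)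
  then show ?thesis using p by (intro exI[of _ d]) (auto simp: d_def)
qed

section \<open>The energy density in a chart\<close>

lemma continuous_preimage_rel_open:
  assumes "continuous_on D f" "open V"
  obtains N where "open N" "{x \<in> D. f x \<in> V} = D \<inter> N"
proof -
  obtain N where "open N" "N \<inter> D = f -` V \<inter> D"
    using assms continuous_on_open_invariant[of D f] by auto
  then show thesis by (intro that[of N]) auto
qed

lemma continuous_on_local:
  fixes f :: "'a::t2_space \<Rightarrow> 'b::topological_space"
  assumes "\<And>x. x \<in> D \<Longrightarrow> \<exists>N. open N \<and> x \<in> N \<and> continuous_on (D \<inter> N) f"
  shows "continuous_on D f"
proof -
  have "continuous (at x within D) f" if "x \<in> D" for x
    using assms[OF that] that at_within_Int_open[of x D]
    by (metis Int_iff continuous_on_eq_continuous_within)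
  then show ?thesis by (simp add: continuous_on_eq_continuous_within)
qed

lemma has_vector_derivative_compose_within:
  assumes "(f has_vector_derivative v) (at t within T)" "(g has_derivative g') (at (f t))"
  shows "((\<lambda>s. g (f s)) has_vector_derivative g' v) (at t within T)"
  using vector_derivative_diff_chain_within[OF assms(1) has_derivative_at_withinI[OF assms(2)]]
  by (simp add: o_def)

text \<open>The congruent matrix is the pull-back of the bilinear form \<open>M\<close> along
  \<open>J\<close>. With a Jacobian as \<open>J\<close>, this matches the tensor law with the chain
  rule for velocities.\<close>

lemma inner_congruence_matrix:
  fixes J M :: "real ^ 'n ^ 'n"
  shows "v \<bullet> ((transpose J ** M ** J) *v w) = (J *v v) \<bullet> (M *v (J *v w))"
  by (simp add: dot_lmul_matrix transpose_matrix_vector flip: matrix_vector_mul_assoc)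
    (metis dot_lmul_matrix inner_commute)

lemma bounded_bilinear_matrix_vector_mult:
  "bounded_bilinear (\<lambda>(M :: real ^ 'n ^ 'm) v. M *v v)"
  unfolding bilinear_conv_bounded_bilinear[symmetric] bilinear_def
  by (auto intro!: linearI simp: matrix_vector_mult_add_rdistrib matrix_vector_right_distrib
      scaleR_matrix_vector_assoc matrix_vector_mult_scaleR)

section \<open>Charts, transition maps and chart independence of the squared speed\<close>

locale riemannian_atlas =
  fixes A :: "('m::{t2_space,second_countable_topology}, 'n::finite) chart set"
    and G :: "('m, 'n) chart \<Rightarrow> real ^ 'n \<Rightarrow> real ^ 'n ^ 'n"
  assumes atlas: "smooth_atlas A" and metric: "riemannian_metric A G"
begin

lemma chart:
  assumes "(U,\<phi>) \<in> A"
  shows "open U" "open (\<phi> ` U)" "homeomorphism U (\<phi> ` U) \<phi> (inv_into U \<phi>)"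
  using assms atlas unfolding smooth_atlas_def by auto

lemma chart_cover: obtains U \<phi> where "(U,\<phi>) \<in> A" "p \<in> U"
proof -
  have "p \<in> (\<Union>(U,\<phi>)\<in>A. U)" using atlas unfolding smooth_atlas_def by simp
  then show thesis using that by auto
qed

lemma inv_chart: "(U,\<phi>) \<in> A \<Longrightarrow> p \<in> U \<Longrightarrow> inv_into U \<phi> (\<phi> p) = p"
  using chart(3) by (auto simp: homeomorphism_def)

lemma chart_smooth: "(U,\<phi>) \<in> A \<Longrightarrow> Ck_on k (\<phi> ` U) (G (U,\<phi>))"
  using metric unfolding riemannian_metric_def smooth_on_def by auto

lemma chart_symmetric: "(U,\<phi>) \<in> A \<Longrightarrow> x \<in> \<phi> ` U \<Longrightarrow> transpose (G (U,\<phi>) x) = G (U,\<phi>) x"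
  using metric unfolding riemannian_metric_def by auto

lemma chart_pos_def:
  "(U,\<phi>) \<in> A \<Longrightarrow> x \<in> \<phi> ` U \<Longrightarrow> v \<noteq> 0 \<Longrightarrow> 0 < v \<bullet> (G (U,\<phi>) x *v v)"
  using metric unfolding riemannian_metric_def by auto

lemma transition:
  assumes "(U,\<phi>) \<in> A" "(V,\<psi>) \<in> A"
  shows "open (\<phi> ` (U \<inter> V))" "Ck_on k (\<phi> ` (U \<inter> V)) (\<psi> \<circ> inv_into U \<phi>)"
proof -
  have "openin (top_of_set (\<phi> ` U)) (\<phi> ` (U \<inter> V))"
    using homeomorphism_imp_open_map[OF chart(3)[OF assms(1)], of "U \<inter> V"] chart(1)[OF assms(2)]
    by (simp add: openin_open_Int)
  then show "open (\<phi> ` (U \<inter> V))"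
    using chart(2)[OF assms(1)] openin_open_trans by blast
  have "\<forall>(U,\<phi>)\<in>A. \<forall>(V,\<psi>)\<in>A. smooth_on (\<phi> ` (U \<inter> V)) (\<psi> \<circ> inv_into U \<phi>)"
    using atlas unfolding smooth_atlas_def by (elim conjE)
  from bspec[OF this assms(1)]
  have "\<forall>(V,\<psi>)\<in>A. smooth_on (\<phi> ` (U \<inter> V)) (\<psi> \<circ> inv_into U \<phi>)" by (simp only: prod.case)
  from bspec[OF this assms(2)] show "Ck_on k (\<phi> ` (U \<inter> V)) (\<psi> \<circ> inv_into U \<phi>)"
    by (simp add: smooth_on_def)
qed

lemma metric_transformation:
  assumes "(U,\<phi>) \<in> A" "(V,\<psi>) \<in> A" "x \<in> \<phi> ` (U \<inter> V)"
  defines "\<tau> \<equiv> \<psi> \<circ> inv_into U \<phi>"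
  defines "J \<equiv> matrix (frechet_derivative \<tau> (at x))"
  shows "G (U,\<phi>) x = transpose J ** G (V,\<psi>) (\<tau> x) ** J"
proof -
  have "\<forall>(U,\<phi>)\<in>A. \<forall>(V,\<psi>)\<in>A. \<forall>x\<in>\<phi> ` (U \<inter> V).
      let \<tau> = \<psi> \<circ> inv_into U \<phi>; J = matrix (frechet_derivative \<tau> (at x))
      in G (U,\<phi>) x = transpose J ** G (V,\<psi>) (\<tau> x) ** J"
    using metric unfolding riemannian_metric_def by (rule conjunct2)
  from bspec[OF this assms(1)] have "\<forall>(V,\<psi>)\<in>A. \<forall>x\<in>\<phi> ` (U \<inter> V).
      let \<tau> = \<psi> \<circ> inv_into U \<phi>; J = matrix (frechet_derivative \<tau> (at x))
      in G (U,\<phi>) x = transpose J ** G (V,\<psi>) (\<tau> x) ** J" by (simp only: prod.case)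
  from bspec[OF this assms(2)] have "\<forall>x\<in>\<phi> ` (U \<inter> V).
      let \<tau> = \<psi> \<circ> inv_into U \<phi>; J = matrix (frechet_derivative \<tau> (at x))
      in G (U,\<phi>) x = transpose J ** G (V,\<psi>) (\<tau> x) ** J" by (simp only: prod.case)
  from bspec[OF this assms(3)] show ?thesis unfolding Let_def J_def \<tau>_def .
qed

text \<open>The chart chosen inside \<open>squared_speed\<close> may differ from the given one.
  Passing to it multiplies the velocity by the Jacobian of the transition map, and the
  transformation law of the metric compensates exactly for that.\<close>

lemma squared_speed_chart:
  assumes UA: "(U,\<phi>) \<in> A" and t: "t \<in> {0..1}" "\<delta> t \<in> U" and cont: "continuous_on {0..1} \<delta>"
    and v: "((\<lambda>s. \<phi> (\<delta> s)) has_vector_derivative v) (at t within {0..1})"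
  shows "squared_speed A G \<delta> t = v \<bullet> (G (U,\<phi>) (\<phi> (\<delta> t)) *v v)"
proof -
  obtain V \<psi> where V: "(SOME c. c \<in> A \<and> \<delta> t \<in> fst c) = (V,\<psi>)" by force
  have "(V,\<psi>) \<in> A \<and> \<delta> t \<in> fst (V,\<psi>)"
    unfolding V[symmetric]
  proof (rule someI_ex)
    obtain W \<kappa> where "(W,\<kappa>) \<in> A" "\<delta> t \<in> W" by (rule chart_cover)
    then show "\<exists>c. c \<in> A \<and> \<delta> t \<in> fst c" by (intro exI[of _ "(W,\<kappa>)"]) simp
  qed
  then have VA: "(V,\<psi>) \<in> A" and "\<delta> t \<in> V" by auto
  define \<tau> where "\<tau> = \<psi> \<circ> inv_into U \<phi>"
  define \<tau>' where "\<tau>' = frechet_derivative \<tau> (at (\<phi> (\<delta> t)))"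
  define J where "J = matrix \<tau>'"
  have in_dom: "\<phi> (\<delta> t) \<in> \<phi> ` (U \<inter> V)" using t \<open>\<delta> t \<in> V\<close> by blast
  obtain \<tau>'' where "\<And>y. y \<in> \<phi> ` (U \<inter> V) \<Longrightarrow> (\<tau> has_derivative \<tau>'' y) (at y within \<phi> ` (U \<inter> V))"
    using transition(2)[OF UA VA, of "Suc 0"] unfolding \<tau>_def by (elim Ck_on_SucE) blast
  then have "(\<tau> has_derivative \<tau>'' (\<phi> (\<delta> t))) (at (\<phi> (\<delta> t)))"
    using in_dom at_within_open[OF in_dom transition(1)[OF UA VA]] by fastforce
  from this frechet_derivative_at[OF this] have \<tau>': "(\<tau> has_derivative \<tau>') (at (\<phi> (\<delta> t)))"
    unfolding \<tau>'_def by (rule subst[rotated])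
  have J: "J *v u = \<tau>' u" for u
    unfolding J_def using matrix_vector_mul(2)[OF has_derivative_linear[OF \<tau>']] by (rule fun_cong)
  \<comment> \<open>The identity between the two coordinate expressions holds only while the curve
    is in both charts, which is the case for times in \<open>{0..1}\<close> near
    \<open>t\<close>.\<close>
  obtain N where N: "open N" "{s \<in> {0..1}. \<delta> s \<in> U \<inter> V} = {0..1} \<inter> N"
    by (rule continuous_preimage_rel_open[OF cont open_Int[OF chart(1)[OF UA] chart(1)[OF VA]]])
  have "velocity (\<psi> \<circ> \<delta>) t = velocity (\<lambda>s. \<tau> (\<phi> (\<delta> s))) t"
  proof (rule velocity_cong_open[OF N(1)])
    have "t \<in> {s \<in> {0..1}. \<delta> s \<in> U \<inter> V}" using t \<open>\<delta> t \<in> V\<close> by blast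
    then show "t \<in> N" unfolding N(2) by blast
    show "(\<psi> \<circ> \<delta>) s = \<tau> (\<phi> (\<delta> s))" if "s \<in> N \<inter> {0..1}" for s
    proof -
      have "s \<in> {s \<in> {0..1}. \<delta> s \<in> U \<inter> V}" unfolding N(2) using that by blast
      then have "\<delta> s \<in> U" by blast
      then show ?thesis using inv_chart[OF UA] by (simp add: \<tau>_def)
    qed
  qed (rule t)
  also have "\<dots> = \<tau>' v"
    by (rule velocity_eq[OF has_vector_derivative_compose_within[OF v \<tau>'] t(1)])
  finally have vel: "velocity (\<psi> \<circ> \<delta>) t = J *v v" by (simp add: J)
  have "G (U,\<phi>) (\<phi> (\<delta> t)) = transpose J ** G (V,\<psi>) (\<tau> (\<phi> (\<delta> t))) ** J"
    unfolding J_def \<tau>'_def \<tau>_def by (rule metric_transformation[OF UA VA in_dom])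
  also have "\<tau> (\<phi> (\<delta> t)) = \<psi> (\<delta> t)" using inv_chart[OF UA t(2)] by (simp add: \<tau>_def)
  finally show ?thesis
    unfolding squared_speed_def V by (simp add: Let_def vel inner_congruence_matrix)
qed

lemma curve_in_chart:
  assumes "(U,\<phi>) \<in> A" "Ck_map_into 2 A {0..1} \<gamma>"
  obtains N where "open N" "{t \<in> {0..1}. \<gamma> t \<in> U} = {0..1} \<inter> N"
    "Ck_on 2 {t \<in> {0..1}. \<gamma> t \<in> U} (\<phi> \<circ> \<gamma>)"
proof -
  have "continuous_on {0..1} \<gamma>" and C2: "Ck_on 2 {t \<in> {0..1}. \<gamma> t \<in> U} (\<phi> \<circ> \<gamma>)"
    using assms unfolding Ck_map_into_def by auto
  from continuous_preimage_rel_open[OF this(1) chart(1)[OF assms(1)]] C2 that show thesis by metis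
qed

text \<open>The chosen chart may jump from one time to the next; near a given time the value is
  nevertheless that computed in one fixed chart, where continuity is visible.\<close>

lemma continuous_on_squared_speed:
  assumes "Ck_map_into 2 A {0..1} \<gamma>"
  shows "continuous_on {0..1} (squared_speed A G \<gamma>)"
proof (rule continuous_on_local)
  fix t :: real assume "t \<in> {0..1}"
  obtain U \<phi> where UA: "(U,\<phi>) \<in> A" and "\<gamma> t \<in> U" by (rule chart_cover)
  define D where "D = {t \<in> {0..1}. \<gamma> t \<in> U}"
  obtain N where N: "open N" "D = {0..1} \<inter> N" and C2: "Ck_on 2 D (\<phi> \<circ> \<gamma>)"
    using curve_in_chart[OF UA assms] unfolding D_def by blast
  note curve = C2_curve[OF C2 N(2,1)]
  have sq: "squared_speed A G \<gamma> s = velocity (\<phi> \<circ> \<gamma>) s \<bullet> (G (U,\<phi>) ((\<phi> \<circ> \<gamma>) s) *v velocity (\<phi> \<circ> \<gamma>) s)"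
    if "s \<in> D" for s
    using squared_speed_chart[OF UA, of s \<gamma>] that curve(1)[OF that] assms
    by (auto simp: D_def o_def Ck_map_into_def)
  have "continuous_on D (\<lambda>s. G (U,\<phi>) ((\<phi> \<circ> \<gamma>) s))"
    by (rule continuous_on_compose2[OF Ck_on_imp_continuous_on[OF chart_smooth[OF UA]]
          Ck_on_imp_continuous_on[OF C2]]) (auto simp: D_def)
  then have "continuous_on D (squared_speed A G \<gamma>)"
    using curve(3) by (simp only: sq cong: continuous_on_cong)
      (intro continuous_intros bounded_bilinear.continuous_on[OF bounded_bilinear_matrix_vector_mult])
  moreover have "t \<in> N" using \<open>t \<in> {0..1}\<close> \<open>\<gamma> t \<in> U\<close> N(2) by (auto simp: D_def)
  ultimately show "\<exists>N. open N \<and> t \<in> N \<and> continuous_on ({0..1} \<inter> N) (squared_speed A G \<gamma>)"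
    using N by blast
qed

lemma continuous_on_Ck_function:
  assumes "Ck_function k A S"
  shows "continuous_on X S"
proof -
  have "continuous_on UNIV S"
  proof (rule continuous_on_local)
    fix p
    obtain U \<phi> where UA: "(U,\<phi>) \<in> A" and "p \<in> U" by (rule chart_cover)
    have "continuous_on (\<phi> ` U) (S \<circ> inv_into U \<phi>)"
      using assms UA unfolding Ck_function_def by (blast intro: Ck_on_imp_continuous_on)
    moreover have "continuous_on U \<phi>" using chart(3)[OF UA] by (simp add: homeomorphism_def)
    ultimately have "continuous_on U (\<lambda>p. (S \<circ> inv_into U \<phi>) (\<phi> p))"
      by (rule continuous_on_compose2) auto
    then have "continuous_on U S"
      by (rule continuous_on_eq) (simp add: inv_chart[OF UA])
    then show "\<exists>N. open N \<and> p \<in> N \<and> continuous_on (UNIV \<inter> N) S"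
      using chart(1)[OF UA] \<open>p \<in> U\<close> by auto
  qed
  then show ?thesis using continuous_on_subset by blast
qed

end

section \<open>Variation of a Lagrangian action\<close>

lemmas has_vector_derivative_mv =
  bounded_bilinear.has_vector_derivative[OF bounded_bilinear_matrix_vector_mult]
lemmas has_vector_derivative_inner =
  bounded_bilinear.has_vector_derivative[OF bounded_bilinear_inner]
lemmas continuous_on_mv =
  bounded_bilinear.continuous_on[OF bounded_bilinear_matrix_vector_mult]

text \<open>In the mechanical convention, kinetic minus potential energy, the potential is
  \<open>- lam * \<sigma>\<close>. This is why the gradient term ends up with a positive sign on the
  right-hand side.\<close>

definition lagrangian ::
    "real \<Rightarrow> (real ^ 'n \<Rightarrow> real ^ 'n ^ 'n) \<Rightarrow> (real ^ 'n \<Rightarrow> real) \<Rightarrow> real ^ 'n \<Rightarrow> real ^ 'n::finite \<Rightarrow> real" where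
  "lagrangian lam g \<sigma> q v = 1/2 * (v \<bullet> (g q *v v)) + lam * \<sigma> q"

text \<open>The variational calculus takes place on an open set of coordinates, without reference to
  the manifold. Continuity of the derivatives is assumed direction by direction, the form in which
  \<open>Ck_on\<close> provides it.\<close>

locale C1_lagrangian =
  fixes W :: "(real ^ 'n::finite) set"
    and g :: "real ^ 'n \<Rightarrow> real ^ 'n ^ 'n" and g' :: "real ^ 'n \<Rightarrow> real ^ 'n \<Rightarrow> real ^ 'n ^ 'n"
    and \<sigma> :: "real ^ 'n \<Rightarrow> real" and \<sigma>' :: "real ^ 'n \<Rightarrow> real ^ 'n \<Rightarrow> real" and lam :: real
  assumes open_W: "open W"
    and g': "\<And>y. y \<in> W \<Longrightarrow> (g has_derivative g' y) (at y)"
    and \<sigma>': "\<And>y. y \<in> W \<Longrightarrow> (\<sigma> has_derivative \<sigma>' y) (at y)"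
    and cont_g': "\<And>v. continuous_on W (\<lambda>y. g' y v)"
    and cont_\<sigma>': "\<And>v. continuous_on W (\<lambda>y. \<sigma>' y v)"
    and symmetric: "\<And>y. y \<in> W \<Longrightarrow> transpose (g y) = g y"
begin

text \<open>With \<open>y\<close>, \<open>v\<close>, \<open>a\<close> as position, velocity and
  acceleration this is the position derivative of the Lagrangian along \<open>w\<close> minus the
  time derivative of the momentum \<open>w \<bullet> (g y *v v)\<close>, the latter written out by
  the product rule.\<close>

definition euler_lagrange :: "real ^ 'n \<Rightarrow> real ^ 'n \<Rightarrow> real ^ 'n \<Rightarrow> real ^ 'n \<Rightarrow> real" where
  "euler_lagrange y v a w = 1/2 * (v \<bullet> (g' y w *v v)) + lam * \<sigma>' y w
     - (w \<bullet> (g' y v *v v) + w \<bullet> (g y *v a))"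

lemma continuous_on_W: "continuous_on W g" "continuous_on W \<sigma>"
  using g'[THEN has_derivative_continuous] \<sigma>'[THEN has_derivative_continuous]
  by (simp_all add: continuous_at_imp_continuous_on)

lemma derivative_scale:
  assumes "y \<in> W"
  shows "g' y (r *\<^sub>R v) = r *\<^sub>R g' y v" "\<sigma>' y (r *\<^sub>R v) = r * \<sigma>' y v"
  using linear_scale[OF has_derivative_linear[OF g'[OF assms]]]
    linear_scale[OF has_derivative_linear[OF \<sigma>'[OF assms]]] by simp_all

lemma symmetric_inner: "y \<in> W \<Longrightarrow> u \<bullet> (g y *v v) = v \<bullet> (g y *v u)"
  using dot_lmul_matrix[of u "g y" v] transpose_matrix_vector[of "g y" u] symmetric[of y]
  by (simp add: inner_commute)

text \<open>Only the term in which \<open>g'\<close> is taken along the moving velocity needs care;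
  it is expanded in the basis.\<close>

lemma continuous_on_euler_lagrange:
  assumes "continuous_on D x" "continuous_on D v" "continuous_on D a" "x ` D \<subseteq> W"
  shows "continuous_on D (\<lambda>t. euler_lagrange (x t) (v t) (a t) w)"
proof -
  have comp: "continuous_on D (\<lambda>t. f (x t))" if "continuous_on W f"
    for f :: "real ^ 'n \<Rightarrow> 'c::topological_space"
    using continuous_on_compose2[OF that assms(1,4)] .
  note comps = comp[OF cont_g'] comp[OF cont_\<sigma>'] comp[OF continuous_on_W(1)]
  have "g' (x t) (v t) = (\<Sum>i\<in>Basis. (v t \<bullet> i) *\<^sub>R g' (x t) i)" if "t \<in> D" for t
  proof -
    have "x t \<in> W" using that assms(4) by blast
    then show ?thesis by (rule linear_eq_sum_Basis[OF has_derivative_linear[OF g']])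
  qed
  note sum = this
  have "continuous_on D (\<lambda>t. \<Sum>i\<in>Basis. (v t \<bullet> i) *\<^sub>R g' (x t) i)"
    by (intro continuous_intros assms comps)
  then have "continuous_on D (\<lambda>t. g' (x t) (v t))"
    by (rule continuous_on_eq) (rule sum[symmetric])
  then show ?thesis
    unfolding euler_lagrange_def
    by (intro continuous_intros continuous_on_mv assms comps)
qed

text \<open>The Leibniz rule gives an integrand that still contains \<open>\<eta>'\<close>. It
  differs from \<open>\<eta>\<close> times the Euler-Lagrange expression by the total derivative of
  \<open>\<eta> * Q\<close>, whose integral vanishes because \<open>\<eta>\<close> is zero at both
  ends.\<close>

lemma action_has_derivative:
  assumes "c < d" "e > 0"
    and x: "\<And>t. t \<in> {c..d} \<Longrightarrow> (x has_vector_derivative x' t) (at t within {c..d})"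
    and x': "\<And>t. t \<in> {c..d} \<Longrightarrow> (x' has_vector_derivative x'' t) (at t within {c..d})"
    and x'': "continuous_on {c..d} x''"
    and \<eta>: "\<And>t. t \<in> {c..d} \<Longrightarrow> (\<eta> has_real_derivative \<eta>' t) (at t within {c..d})"
    and \<eta>': "continuous_on {c..d} \<eta>'" and ends: "\<eta> c = 0" "\<eta> d = 0"
    and W: "\<And>s t. s \<in> {-e<..<e} \<Longrightarrow> t \<in> {c..d} \<Longrightarrow> x t + (s * \<eta> t) *\<^sub>R w \<in> W"
  shows "((\<lambda>s. integral {c..d} (\<lambda>t.
            lagrangian lam g \<sigma> (x t + (s * \<eta> t) *\<^sub>R w) (x' t + (s * \<eta>' t) *\<^sub>R w)))
          has_real_derivative integral {c..d} (\<lambda>t. \<eta> t * euler_lagrange (x t) (x' t) (x'' t) w)) (at 0)"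
proof -
  define q where "q s t = x t + (s * \<eta> t) *\<^sub>R w" for s t
  define v where "v s t = x' t + (s * \<eta>' t) *\<^sub>R w" for s t
  define L' where "L' s t = 1/2 * (v s t \<bullet> (g (q s t) *v (\<eta>' t *\<^sub>R w) + (\<eta> t *\<^sub>R g' (q s t) w) *v v s t)
      + (\<eta>' t *\<^sub>R w) \<bullet> (g (q s t) *v v s t)) + lam * (\<eta> t * \<sigma>' (q s t) w)" for s t
  have q: "q s t \<in> W" if "s \<in> {-e<..<e}" "t \<in> {c..d}" for s t
    using W[OF that] by (simp add: q_def)
  have deriv: "((\<lambda>s. lagrangian lam g \<sigma> (q s t) (v s t)) has_real_derivative L' s t)
      (at s within {-e<..<e})" if st: "s \<in> {-e<..<e}" "t \<in> {c..d}" for s t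
  proof -
    have "((\<lambda>s. q s t) has_vector_derivative \<eta> t *\<^sub>R w) (at s within {-e<..<e})"
      unfolding q_def by (auto intro!: derivative_eq_intros simp: has_vector_derivative_def)
    note q' = has_vector_derivative_compose_within[OF this]
    have v': "((\<lambda>s. v s t) has_vector_derivative \<eta>' t *\<^sub>R w) (at s within {-e<..<e})"
      unfolding v_def by (auto intro!: derivative_eq_intros simp: has_vector_derivative_def)
    have gq: "((\<lambda>s. g (q s t)) has_vector_derivative \<eta> t *\<^sub>R g' (q s t) w) (at s within {-e<..<e})"
      using q'[OF g'[OF q[OF st]]] by (simp add: derivative_scale[OF q[OF st]])
    have \<sigma>q: "((\<lambda>s. \<sigma> (q s t)) has_vector_derivative \<eta> t * \<sigma>' (q s t) w) (at s within {-e<..<e})"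
      using q'[OF \<sigma>'[OF q[OF st]]] by (simp add: derivative_scale[OF q[OF st]])
    have "((\<lambda>s. v s t \<bullet> (g (q s t) *v v s t)) has_vector_derivative
        v s t \<bullet> (g (q s t) *v (\<eta>' t *\<^sub>R w) + (\<eta> t *\<^sub>R g' (q s t) w) *v v s t)
        + (\<eta>' t *\<^sub>R w) \<bullet> (g (q s t) *v v s t)) (at s within {-e<..<e})"
      by (rule has_vector_derivative_inner[OF v' has_vector_derivative_mv[OF gq v']])
    with \<sigma>q show ?thesis
      unfolding lagrangian_def L'_def has_real_derivative_iff_has_vector_derivative[symmetric]
      by (intro DERIV_add DERIV_cmult)
  qed
  have cx: "continuous_on {c..d} x" "continuous_on {c..d} x'" "continuous_on {c..d} \<eta>"
    unfolding continuous_on_eq_continuous_within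
    using x x' \<eta> has_vector_derivative_continuous DERIV_continuous by blast+
  let ?R = "{-e<..<e} \<times> {c..d}"
  have snd: "continuous_on ?R (\<lambda>p. f (snd p))" if "continuous_on {c..d} f"
    for f :: "real \<Rightarrow> 'c::topological_space"
    by (rule continuous_on_compose2[OF that]) (auto intro: continuous_intros)
  note cont_snd = cx[THEN snd] \<eta>'[THEN snd]
  have cq: "continuous_on ?R (\<lambda>p. q (fst p) (snd p))"
    unfolding q_def by (intro continuous_intros cont_snd)
  have cv: "continuous_on ?R (\<lambda>p. v (fst p) (snd p))"
    unfolding v_def by (intro continuous_intros cont_snd)
  have comp: "continuous_on ?R (\<lambda>p. f (q (fst p) (snd p)))" if "continuous_on W f"
    for f :: "real ^ 'n \<Rightarrow> 'c::topological_space"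
    by (rule continuous_on_compose2[OF that cq]) (use q in auto)
  note comps = comp[OF cont_g'] comp[OF cont_\<sigma>'] comp[OF continuous_on_W(1)]
    comp[OF continuous_on_W(2)]
  have cL': "continuous_on ?R (\<lambda>(s,t). L' s t)"
    unfolding L'_def case_prod_unfold
    by (intro continuous_intros continuous_on_mv cont_snd cv comps)
  have cL: "continuous_on ?R (\<lambda>p. lagrangian lam g \<sigma> (q (fst p) (snd p)) (v (fst p) (snd p)))"
    unfolding lagrangian_def by (intro continuous_intros continuous_on_mv cv comps)
  have "(\<lambda>t. lagrangian lam g \<sigma> (q s t) (v s t)) integrable_on cbox c d" if "s \<in> {-e<..<e}" for s
    unfolding box_real
  proof (rule integrable_continuous_real)
    have "continuous_on {c..d} (Pair s)" by (intro continuous_intros)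
    from continuous_on_compose2[OF cL this] that
    show "continuous_on {c..d} (\<lambda>t. lagrangian lam g \<sigma> (q s t) (v s t))" by fastforce
  qed
  then have "((\<lambda>s. integral (cbox c d) (\<lambda>t. lagrangian lam g \<sigma> (q s t) (v s t)))
      has_real_derivative integral (cbox c d) (L' 0)) (at 0 within {-e<..<e})"
    using deriv cL' \<open>e > 0\<close> by (intro leibniz_rule_field_derivative) auto
  then have main: "((\<lambda>s. integral {c..d} (\<lambda>t. lagrangian lam g \<sigma> (q s t) (v s t)))
      has_real_derivative integral {c..d} (L' 0)) (at 0)"
    using \<open>e > 0\<close> by (simp add: at_within_open[of 0 "{-e<..<e}"])
  \<comment> \<open>The momentum of the unvaried curve paired with \<open>w\<close>. Differentiating
    it is what calls for a second derivative of \<open>x\<close>.\<close>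
  define Q where "Q t = w \<bullet> (g (x t) *v x' t)" for t
  define Q' where "Q' t = w \<bullet> (g (x t) *v x'' t + g' (x t) (x' t) *v x' t)" for t
  have xW: "x t \<in> W" if "t \<in> {c..d}" for t
    using W[of 0 t] that \<open>e > 0\<close> by simp
  have Q: "(Q has_vector_derivative Q' t) (at t within {c..d})" if t: "t \<in> {c..d}" for t
  proof -
    have "((\<lambda>t. g (x t) *v x' t) has_vector_derivative g (x t) *v x'' t + g' (x t) (x' t) *v x' t)
        (at t within {c..d})"
      by (rule has_vector_derivative_mv[OF has_vector_derivative_compose_within[OF x[OF t] g'[OF xW[OF t]]] x'[OF t]])
    from has_vector_derivative_inner[OF has_vector_derivative_const this, of w] show ?thesis
      by (simp add: Q_def[abs_def] Q'_def)
  qed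
  have "((\<lambda>t. \<eta> t * Q t) has_vector_derivative \<eta> t * Q' t + \<eta>' t * Q t) (at t within {c..d})"
    if t: "t \<in> {c..d}" for t
    using DERIV_mult[OF \<eta>[OF t] Q[OF t, folded has_real_derivative_iff_has_vector_derivative]]
    by (simp add: has_real_derivative_iff_has_vector_derivative algebra_simps)
  from fundamental_theorem_of_calculus[OF less_imp_le[OF \<open>c < d\<close>] this]
  have parts: "((\<lambda>t. \<eta> t * Q' t + \<eta>' t * Q t) has_integral 0) {c..d}"
    using ends by simp
  have "continuous_on {c..d} (\<lambda>t. \<eta> t * euler_lagrange (x t) (x' t) (x'' t) w)"
    using xW by (intro continuous_intros cx continuous_on_euler_lagrange x'') auto
  then have "((\<lambda>t. \<eta> t * euler_lagrange (x t) (x' t) (x'' t) w) has_integral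
      integral {c..d} (\<lambda>t. \<eta> t * euler_lagrange (x t) (x' t) (x'' t) w)) {c..d}"
    by (intro integrable_integral integrable_continuous_real)
  from has_integral_add[OF this parts]
  have "((\<lambda>t. \<eta> t * euler_lagrange (x t) (x' t) (x'' t) w + (\<eta> t * Q' t + \<eta>' t * Q t)) has_integral
      integral {c..d} (\<lambda>t. \<eta> t * euler_lagrange (x t) (x' t) (x'' t) w)) {c..d}" by simp
  \<comment> \<open>Symmetry of the metric merges the two terms with \<open>\<eta>'\<close>, one
    from each velocity slot, and so cancels the factor \<open>1/2\<close> in front of them.\<close>
  moreover have "\<eta> t * euler_lagrange (x t) (x' t) (x'' t) w + (\<eta> t * Q' t + \<eta>' t * Q t) = L' 0 t"
    if "t \<in> {c..d}" for t
    using symmetric_inner[OF xW[OF that], of w "x' t"]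
    by (simp add: euler_lagrange_def Q_def Q'_def L'_def q_def v_def algebra_simps
        inner_add_right matrix_vector_mult_scaleR scaleR_matrix_vector_assoc[symmetric])
  ultimately have "(L' 0 has_integral
      integral {c..d} (\<lambda>t. \<eta> t * euler_lagrange (x t) (x' t) (x'' t) w)) {c..d}"
    by (rule has_integral_eq[rotated])
  with main show ?thesis
    by (simp add: integral_unique q_def v_def)
qed

end

section \<open>Variations supported in a chart\<close>

text \<open>\<open>h\<close> is \<open>f\<close> plus the zero extension of \<open>k - f\<close>, so
  its integrability comes out of the argument, whatever happens at \<open>c\<close> and
  \<open>d\<close>. It isolates the part of the energy that a variation changes.\<close>

lemma integral_replace_on_subinterval:
  fixes f h k :: "real \<Rightarrow> real"
  assumes f: "continuous_on {a..b} f" and k: "continuous_on {c..d} k" and sub: "{c..d} \<subseteq> {a..b}"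
    and off: "\<And>t. t \<in> {a..b} \<Longrightarrow> t \<notin> {c..d} \<Longrightarrow> h t = f t"
    and on: "\<And>t. t \<in> {c..d} \<Longrightarrow> h t = k t"
  shows "integral {a..b} h = integral {a..b} f - integral {c..d} f + integral {c..d} k"
proof -
  have "(f has_integral integral {a..b} f) {a..b}"
    using f by (intro integrable_integral integrable_continuous_real)
  moreover have "((\<lambda>t. k t - f t) has_integral (integral {c..d} k - integral {c..d} f)) {c..d}"
    using k continuous_on_subset[OF f sub]
    by (intro has_integral_diff integrable_integral integrable_continuous_real)
  then have "((\<lambda>t. if t \<in> {c..d} then k t - f t else 0) has_integral
      (integral {c..d} k - integral {c..d} f)) {a..b}"
    by (rule has_integral_restrict[OF sub, THEN iffD2])
  ultimately have "((\<lambda>t. f t + (if t \<in> {c..d} then k t - f t else 0)) has_integral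
      (integral {a..b} f + (integral {c..d} k - integral {c..d} f))) {a..b}"
    by (rule has_integral_add)
  then have "(h has_integral (integral {a..b} f + (integral {c..d} k - integral {c..d} f))) {a..b}"
    by (rule has_integral_eq[rotated]) (use off on in auto)
  then show ?thesis by (simp add: integral_unique)
qed

text \<open>On an open set derivatives are unique, so the witness hidden in \<open>Ck_on\<close> may
  be replaced by \<open>frechet_derivative\<close>. The Euler-Lagrange expression can then be
  written in terms of the metric and \<open>S\<close> alone.\<close>

lemma C1_on_open:
  assumes "Ck_on (Suc 0) W f" "open W"
  shows "\<And>y. y \<in> W \<Longrightarrow> (f has_derivative frechet_derivative f (at y)) (at y)"
    and "continuous_on W (\<lambda>y. frechet_derivative f (at y) v)"
proof -
  obtain f' where f': "\<And>y. y \<in> W \<Longrightarrow> (f has_derivative f' y) (at y within W)"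
    "\<And>v. Ck_on 0 W (\<lambda>y. f' y v)"
    using assms(1) by (elim Ck_on_SucE) blast
  have deriv: "(f has_derivative f' y) (at y)" if "y \<in> W" for y
    using f'(1)[OF that] at_within_open[OF that assms(2)] by simp
  have eq: "f' y = frechet_derivative f (at y)" if "y \<in> W" for y
    by (rule frechet_derivative_at[OF deriv[OF that]])
  show "(f has_derivative frechet_derivative f (at y)) (at y)" if "y \<in> W" for y
    using deriv[OF that] eq[OF that] by simp
  have "continuous_on W (\<lambda>y. f' y v)" using f'(2) by simp
  then show "continuous_on W (\<lambda>y. frechet_derivative f (at y) v)"
    by (rule continuous_on_eq) (simp add: eq)
qed

lemma partial_eq_derivative:
  assumes "(f has_derivative f') (at x)"
  shows "partial p f x = f' (axis p 1)"
proof -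
  have "((\<lambda>h. x + h *\<^sub>R axis p 1) has_vector_derivative axis p 1) (at 0)"
    by (auto intro!: derivative_eq_intros simp: has_vector_derivative_def)
  from has_vector_derivative_compose_within[OF this, of f f'] assms
  have "((\<lambda>h. f (x + h *\<^sub>R axis p 1)) has_real_derivative f' (axis p 1)) (at 0)"
    by (simp add: has_real_derivative_iff_has_vector_derivative)
  then show ?thesis
    unfolding partial_def by (rule DERIV_imp_deriv)
qed

context riemannian_atlas
begin

lemma chart_lagrangian:
  assumes UA: "(U,\<phi>) \<in> A" and "Ck_function 1 A S"
  shows "C1_lagrangian (\<phi> ` U) (G (U,\<phi>)) (\<lambda>y. frechet_derivative (G (U,\<phi>)) (at y))
    (S \<circ> inv_into U \<phi>) (\<lambda>y. frechet_derivative (S \<circ> inv_into U \<phi>) (at y))"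
proof -
  have "Ck_on (Suc 0) (\<phi> ` U) (S \<circ> inv_into U \<phi>)"
    using assms unfolding Ck_function_def by auto
  note S = C1_on_open[OF this chart(2)[OF UA]]
  note G = C1_on_open[OF chart_smooth[OF UA, of "Suc 0"] chart(2)[OF UA]]
  show ?thesis
    by (rule C1_lagrangian.intro[OF chart(2)[OF UA] G(1) S(1) G(2) S(2) chart_symmetric[OF UA]])
qed

end

text \<open>The bound \<open>e\<close> keeps the displaced coordinates inside the chart. Such an
  \<open>e\<close> is found later, by compactness of the coordinate arc over
  \<open>{c..d}\<close>.\<close>

locale bump_variation = riemannian_atlas A G
  for A :: "('m::{t2_space,second_countable_topology}, 'n::finite) chart set"
    and G :: "('m, 'n) chart \<Rightarrow> real ^ 'n \<Rightarrow> real ^ 'n ^ 'n" +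
  fixes U :: "'m set" and \<phi> :: "'m \<Rightarrow> real ^ 'n" and \<gamma> :: "real \<Rightarrow> 'm" and c d e :: real and w :: "real ^ 'n"
  assumes UA: "(U,\<phi>) \<in> A" and \<gamma>: "Ck_map_into 2 A {0..1} \<gamma>"
    and cd: "0 < c" "c < d" "d < 1" and in_U: "\<And>t. t \<in> {c..d} \<Longrightarrow> \<gamma> t \<in> U" and e_pos: "e > 0"
    and in_chart: "\<And>s t. s \<in> {-e<..<e} \<Longrightarrow> t \<in> {c..d} \<Longrightarrow>
      \<phi> (\<gamma> t) + (s * bump c d t) *\<^sub>R w \<in> \<phi> ` U"
begin

definition q :: "real \<Rightarrow> real \<Rightarrow> real ^ 'n" where
  "q s t = \<phi> (\<gamma> t) + (s * bump c d t) *\<^sub>R w"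

text \<open>Meaningful for \<open>s\<close> in \<open>{-e<..<e}\<close>; for other \<open>s\<close>
  the point \<open>q s t\<close> may leave the chart, where \<open>inv_into\<close> has no geometric
  meaning.\<close>

definition H :: "real \<Rightarrow> real \<Rightarrow> 'm" where
  "H s t = (if t \<in> {c..d} then inv_into U \<phi> (q s t) else \<gamma> t)"

text \<open>Cutting down to \<open>{0<..<1}\<close> makes this set open in the real line. It
  contains \<open>{c..d}\<close> and leaves room around it, so the chart formula is available on
  both sides of \<open>c\<close> and of \<open>d\<close>.\<close>

definition interior_times :: "real set" where
  "interior_times = {t \<in> {0<..<1}. \<gamma> t \<in> U}"

lemma continuous_\<gamma>: "continuous_on {0..1} \<gamma>"
  using \<gamma> by (simp add: Ck_map_into_def)

lemma open_interior_times: "open interior_times"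
proof -
  have "{t \<in> {0<..<1}. \<gamma> t \<in> U} = {0<..<1} \<inter> \<gamma> -` U" by auto
  moreover have "continuous_on {0<..<1} \<gamma>"
    by (rule continuous_on_subset[OF continuous_\<gamma>]) auto
  ultimately show ?thesis
    unfolding interior_times_def
    using continuous_open_preimage[of "{0<..<1}" \<gamma> U] chart(1)[OF UA] by simp
qed

lemma support_interior: "{c..d} \<subseteq> interior_times"
  using cd in_U by (auto simp: interior_times_def)

lemma q_in_chart:
  assumes "s \<in> {-e<..<e}" "t \<in> interior_times"
  shows "q s t \<in> \<phi> ` U"
proof (cases "t \<in> {c..d}")
  case True
  then show ?thesis using in_chart assms by (simp add: q_def)
next
  case False
  then have "bump c d t = 0" using cd by (intro bump_eq_0) auto
  then show ?thesis using assms by (simp add: q_def interior_times_def)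
qed

lemma H_off: "t \<notin> {c..d} \<Longrightarrow> H s t = \<gamma> t"
  unfolding H_def by (rule if_not_P)

text \<open>Outside \<open>{c..d}\<close> the bump is zero and the chart formula merely returns
  \<open>\<gamma> t\<close>. Hence the two branches of \<open>H\<close> fit together across
  \<open>c\<close> and \<open>d\<close>.\<close>

lemma H_interior:
  assumes "t \<in> interior_times"
  shows "H s t = inv_into U \<phi> (q s t)"
proof (cases "t \<in> {c..d}")
  case False
  then have "bump c d t = 0" using cd by (intro bump_eq_0) auto
  then show ?thesis
    using assms False inv_chart[OF UA] by (simp add: q_def H_def interior_times_def)
qed (simp add: H_def)

lemma H_in_U:
  assumes "s \<in> {-e<..<e}" "t \<in> interior_times"
  shows "H s t \<in> U" "\<phi> (H s t) = q s t"
  using q_in_chart[OF assms] unfolding H_interior[OF assms(2)]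
  by (auto intro: inv_into_into f_inv_into_f)

lemma H_zero: "H 0 = \<gamma>"
proof
  fix t
  show "H 0 t = \<gamma> t"
    by (cases "t \<in> {c..d}") (simp_all only: H_def q_def if_True if_False in_U inv_chart[OF UA]
        mult_zero_left scaleR_zero_left add_0_right)
qed

lemma C2_coordinates: "Ck_on 2 {t \<in> {0..1}. \<gamma> t \<in> U} (\<lambda>t. \<phi> (\<gamma> t))"
  using \<gamma> UA unfolding Ck_map_into_def by (auto simp: o_def)

lemma C2_q: "Ck_on 2 ({-e<..<e} \<times> interior_times) (\<lambda>p. q (fst p) (snd p))"
  unfolding q_def
proof (intro Ck_on_add)
  have snd: "Ck_on 2 X (snd :: real \<times> real \<Rightarrow> real)" and fst: "Ck_on 2 X (fst :: real \<times> real \<Rightarrow> real)" for X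
    by (auto intro: Ck_on_linear bounded_linear_fst bounded_linear_snd)
  show "Ck_on 2 ({-e<..<e} \<times> interior_times) (\<lambda>p. \<phi> (\<gamma> (snd p)))"
    by (rule Ck_on_compose[OF C2_coordinates snd]) (auto simp: interior_times_def)
  have "Ck_on 2 ({-e<..<e} \<times> interior_times) (\<lambda>p. (fst p *\<^sub>R bump c d (snd p)) *\<^sub>R w)"
    by (rule Ck_on_scaleR[OF Ck_on_scaleR[OF fst Ck_on_compose[OF C2_bump[of UNIV] snd]] Ck_on_const]) simp
  then show "Ck_on 2 ({-e<..<e} \<times> interior_times) (\<lambda>p. (fst p * bump c d (snd p)) *\<^sub>R w)"
    by simp
qed

text \<open>The two cylinders overlap where the curve is in the chart and the bump is already zero.
  On the first, \<open>H\<close> does not depend on \<open>s\<close>; on the second it is given by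
  coordinates.\<close>

lemma open_cover_strip:
  obtains N1 N2 where "open N1" "open N2" "{-e<..<e} \<times> {0..1} \<subseteq> N1 \<union> N2"
    "\<And>p. p \<in> ({-e<..<e} \<times> {0..1}) \<inter> N1 \<Longrightarrow> snd p \<in> {0..1} \<and> H (fst p) (snd p) = \<gamma> (snd p)"
    "\<And>p. p \<in> ({-e<..<e} \<times> {0..1}) \<inter> N2 \<Longrightarrow> fst p \<in> {-e<..<e} \<and> snd p \<in> interior_times"
proof (rule that[of "UNIV \<times> - {c..d}" "UNIV \<times> interior_times"])
  show "open (UNIV \<times> - {c..d} :: (real \<times> real) set)" by (intro open_Times) auto
  show "open (UNIV \<times> interior_times :: (real \<times> real) set)"
    by (intro open_Times open_interior_times) auto
qed (use support_interior in \<open>auto simp: H_def\<close>)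

lemma continuous_H: "continuous_on ({-e<..<e} \<times> {0..1}) (\<lambda>(s, t). H s t)"
proof -
  let ?R = "{-e<..<e} \<times> {0..1}"
  obtain N1 N2 where N: "open N1" "open N2" "?R \<subseteq> N1 \<union> N2"
    and N1: "\<And>p. p \<in> ?R \<inter> N1 \<Longrightarrow> snd p \<in> {0..1} \<and> H (fst p) (snd p) = \<gamma> (snd p)"
    and N2: "\<And>p. p \<in> ?R \<inter> N2 \<Longrightarrow> fst p \<in> {-e<..<e} \<and> snd p \<in> interior_times"
    by (rule open_cover_strip) blast
  have "continuous_on (?R \<inter> N1) (\<lambda>p. \<gamma> (snd p))"
    by (rule continuous_on_compose2[OF continuous_\<gamma>]) (use N1 in \<open>auto intro: continuous_intros\<close>)
  then have c1: "continuous_on (?R \<inter> N1) (\<lambda>(s, t). H s t)"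
    by (rule continuous_on_eq) (use N1 in \<open>simp add: case_prod_unfold\<close>)
  have "continuous_on (\<phi> ` U) (inv_into U \<phi>)"
    using chart(3)[OF UA] by (simp add: homeomorphism_def)
  moreover have "continuous_on (?R \<inter> N2) (\<lambda>p. q (fst p) (snd p))"
    by (rule continuous_on_subset[OF Ck_on_imp_continuous_on[OF C2_q]]) (use N2 in \<open>auto simp: mem_Times_iff\<close>)
  ultimately have "continuous_on (?R \<inter> N2) (\<lambda>p. inv_into U \<phi> (q (fst p) (snd p)))"
    by (rule continuous_on_compose2) (use N2 q_in_chart in blast)
  then have c2: "continuous_on (?R \<inter> N2) (\<lambda>(s, t). H s t)"
    by (rule continuous_on_eq) (use N2 in \<open>simp add: case_prod_unfold H_interior\<close>)
  show ?thesis
    by (rule continuous_on_local) (use N c1 c2 in blast)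
qed

text \<open>In a target chart \<open>H\<close> is \<open>\<psi> \<circ> \<gamma>\<close> after the
  projection to \<open>t\<close> on one cylinder, and a transition map applied to \<open>q\<close>
  on the other. Both are of class C2 and are glued by \<open>Ck_on_local\<close>.\<close>

lemma C2_H: "Ck_map_into 2 A ({-e<..<e} \<times> {0..1}) (\<lambda>(s, t). H s t)"
proof -
  let ?R = "{-e<..<e} \<times> {0..1}"
  let ?h = "\<lambda>(s, t). H s t"
  obtain N1 N2 where N: "open N1" "open N2" "?R \<subseteq> N1 \<union> N2"
    and N1: "\<And>p. p \<in> ?R \<inter> N1 \<Longrightarrow> snd p \<in> {0..1} \<and> H (fst p) (snd p) = \<gamma> (snd p)"
    and N2: "\<And>p. p \<in> ?R \<inter> N2 \<Longrightarrow> fst p \<in> {-e<..<e} \<and> snd p \<in> interior_times"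
    by (rule open_cover_strip) blast
  have "Ck_on 2 {p \<in> ?R. ?h p \<in> V} (\<psi> \<circ> ?h)" if VA: "(V,\<psi>) \<in> A" for V \<psi>
  proof -
    define D where "D = {p \<in> ?R. ?h p \<in> V}"
    \<comment> \<open>Relative openness of \<open>D\<close>, drawn from the continuity of
      \<open>H\<close>, is what gives unique derivatives within \<open>D\<close>.\<close>
    obtain M where M: "open M" "D = ?R \<inter> M"
      unfolding D_def by (rule continuous_preimage_rel_open[OF continuous_H chart(1)[OF VA]])
    have D: "p \<in> ?R" "H (fst p) (snd p) \<in> V" if "p \<in> D" for p
      using that by (auto simp: D_def)
    have "Ck_on 2 {t \<in> {0..1}. \<gamma> t \<in> V} (\<psi> \<circ> \<gamma>)"
      using \<gamma> VA unfolding Ck_map_into_def by auto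
    then have "Ck_on 2 (D \<inter> N1) (\<lambda>p. (\<psi> \<circ> \<gamma>) (snd p))"
    proof (rule Ck_on_compose)
      show "snd ` (D \<inter> N1) \<subseteq> {t \<in> {0..1}. \<gamma> t \<in> V}" using N1 D by fastforce
    qed (intro Ck_on_linear bounded_linear_snd)
    then have D1: "Ck_on 2 (D \<inter> N1) (\<psi> \<circ> ?h)"
      by (rule Ck_on_cong[THEN iffD2, rotated]) (use N1 D in \<open>simp add: case_prod_unfold\<close>)
    have "Ck_on 2 (D \<inter> N2) (\<lambda>p. (\<psi> \<circ> inv_into U \<phi>) (q (fst p) (snd p)))"
    proof (rule Ck_on_compose[OF transition(2)[OF UA VA]])
      show "Ck_on 2 (D \<inter> N2) (\<lambda>p. q (fst p) (snd p))"
        by (rule Ck_on_subset[OF C2_q]) (use N2 D(1) in \<open>blast intro: mem_Times_iff[THEN iffD2]\<close>)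
      show "(\<lambda>p. q (fst p) (snd p)) ` (D \<inter> N2) \<subseteq> \<phi> ` (U \<inter> V)"
      proof
        fix y assume "y \<in> (\<lambda>p. q (fst p) (snd p)) ` (D \<inter> N2)"
        then obtain p where p: "p \<in> D" "p \<in> N2" "y = q (fst p) (snd p)" by blast
        then have "fst p \<in> {-e<..<e}" "snd p \<in> interior_times" using N2 D by blast+
        from H_in_U[OF this] D(2)[OF p(1)] p(3) show "y \<in> \<phi> ` (U \<inter> V)" by (metis IntI imageI)
      qed
    qed
    then have D2: "Ck_on 2 (D \<inter> N2) (\<psi> \<circ> ?h)"
      by (rule Ck_on_cong[THEN iffD2, rotated]) (use N2 D(1) in \<open>simp add: case_prod_unfold H_interior\<close>)
    have "Ck_on 2 D (\<psi> \<circ> ?h)"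
    proof (rule Ck_on_local)
      show "\<exists>r. 0 < \<bar>r\<bar> \<and> \<bar>r\<bar> < \<epsilon> \<and> p + r *\<^sub>R i \<in> D" if "p \<in> D" "i \<in> Basis" "\<epsilon> > 0" for p i \<epsilon>
        by (rule unique_derivatives_rel_open_strip[OF M(2,1) that])
      show "\<exists>N. open N \<and> p \<in> N \<and> Ck_on 2 (D \<inter> N) (\<psi> \<circ> ?h)" if "p \<in> D" for p
        using D(1)[OF that] N D1 D2 by blast
    qed
    then show ?thesis by (simp add: D_def)
  qed
  then show ?thesis using continuous_H unfolding Ck_map_into_def by auto
qed

lemma variation_H: "variation A \<gamma> H"
  unfolding variation_def
  using C2_H e_pos cd by (intro exI[of _ e]) (simp add: H_zero H_off)

text \<open>Every slice must be an admissible competitor for the minimization; its regularity is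
  inherited along the affine map from \<open>t\<close> to \<open>(s, t)\<close>.\<close>

lemma H_curve:
  assumes "s \<in> {-e<..<e}"
  shows "Ck_map_into 2 A {0..1} (H s)" "H s 0 = \<gamma> 0" "H s 1 = \<gamma> 1"
proof -
  have slice: "Ck_on k {0..1} (Pair s)" for k
    using Ck_on_affine[OF bounded_linear_Pair[OF bounded_linear_zero bounded_linear_ident], of k "{0..1}" "(s, 0)"]
    by simp
  have "continuous_on {0..1} (H s)"
    using continuous_on_compose2[OF continuous_H Ck_on_imp_continuous_on[OF slice]] assms by fastforce
  moreover have "Ck_on 2 {t \<in> {0..1}. H s t \<in> V} (\<psi> \<circ> H s)" if "(V,\<psi>) \<in> A" for V \<psi>
  proof -
    have "Ck_on 2 {p \<in> {-e<..<e} \<times> {0..1}. (case p of (s, t) \<Rightarrow> H s t) \<in> V} (\<psi> \<circ> (\<lambda>(s, t). H s t))"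
      using C2_H that unfolding Ck_map_into_def by auto
    from Ck_on_compose[OF this Ck_on_subset[OF slice], of "{t \<in> {0..1}. H s t \<in> V}"] assms
    show ?thesis by (fastforce simp: o_def)
  qed
  ultimately show "Ck_map_into 2 A {0..1} (H s)" unfolding Ck_map_into_def by auto
qed (use cd in \<open>auto simp: H_off\<close>)

end

section \<open>Energy along the bump variation and its derivative\<close>

context bump_variation
begin

abbreviation "x \<equiv> \<phi> \<circ> \<gamma>"

definition velocity_q :: "real \<Rightarrow> real \<Rightarrow> real ^ 'n" where
  "velocity_q s t = velocity x t + (s * bump' c d t) *\<^sub>R w"

lemma coordinate_curve:
  obtains N where "open N" "{t \<in> {0..1}. \<gamma> t \<in> U} = {0..1} \<inter> N"
    "Ck_on 2 {t \<in> {0..1}. \<gamma> t \<in> U} x"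
  using curve_in_chart[OF UA \<gamma>] by blast

lemma coordinate_derivatives:
  assumes "t \<in> {0..1}" "\<gamma> t \<in> U"
  shows "(x has_vector_derivative velocity x t) (at t within {0..1})"
    and "(velocity x has_vector_derivative acceleration x t) (at t within {0..1})"
proof -
  obtain N where N: "open N" "{t \<in> {0..1}. \<gamma> t \<in> U} = {0..1} \<inter> N"
    "Ck_on 2 {t \<in> {0..1}. \<gamma> t \<in> U} x"
    by (rule coordinate_curve)
  show "(x has_vector_derivative velocity x t) (at t within {0..1})"
    "(velocity x has_vector_derivative acceleration x t) (at t within {0..1})"
    using C2_curve(1,2)[OF N(3,2,1)] assms by auto
qed

lemma continuous_coordinates:
  "continuous_on {c..d} x" "continuous_on {c..d} (velocity x)" "continuous_on {c..d} (acceleration x)"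
proof -
  obtain N where N: "open N" "{t \<in> {0..1}. \<gamma> t \<in> U} = {0..1} \<inter> N"
    "Ck_on 2 {t \<in> {0..1}. \<gamma> t \<in> U} x"
    by (rule coordinate_curve)
  have sub: "{c..d} \<subseteq> {t \<in> {0..1}. \<gamma> t \<in> U}" using cd in_U by auto
  show "continuous_on {c..d} x" "continuous_on {c..d} (velocity x)" "continuous_on {c..d} (acceleration x)"
    by (rule continuous_on_subset[OF _ sub], rule Ck_on_imp_continuous_on[OF N(3)])
      (rule continuous_on_subset[OF C2_curve(3)[OF N(3,2,1)] sub]
        continuous_on_subset[OF C2_curve(4)[OF N(3,2,1)] sub])+
qed

text \<open>Both sides select the same chart, since the choice depends only on the point, and there
  the curves agree on the open complement of \<open>{c..d}\<close>.\<close>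

lemma squared_speed_off:
  assumes "t \<in> {0..1}" "t \<notin> {c..d}"
  shows "squared_speed A G (H s) t = squared_speed A G \<gamma> t"
proof -
  have "velocity (\<psi> \<circ> H s) t = velocity (\<psi> \<circ> \<gamma>) t" for \<psi> :: "'m \<Rightarrow> real ^ 'n"
    by (rule velocity_cong_open[of "- {c..d}"]) (use assms in \<open>auto simp: H_off\<close>)
  then show ?thesis
    unfolding squared_speed_def by (simp add: H_off[OF assms(2)])
qed

lemma squared_speed_on:
  assumes s: "s \<in> {-e<..<e}" and t: "t \<in> {c..d}"
  shows "squared_speed A G (H s) t = velocity_q s t \<bullet> (G (U,\<phi>) (q s t) *v velocity_q s t)"
proof -
  have t01: "t \<in> {0..1}" and ti: "t \<in> interior_times" and "\<gamma> t \<in> U"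
    using t cd support_interior in_U by auto
  have "((\<lambda>t. s * bump c d t) has_real_derivative s * bump' c d t) (at t within {0..1})"
    by (intro DERIV_cmult has_field_derivative_at_within[OF DERIV_bump])
  then have "((\<lambda>t. (s * bump c d t) *\<^sub>R w) has_vector_derivative (s * bump' c d t) *\<^sub>R w) (at t within {0..1})"
    using has_vector_derivative_scaleR[OF _ has_vector_derivative_const[of w]] by fastforce
  from has_vector_derivative_add[OF coordinate_derivatives(1)[OF t01 \<open>\<gamma> t \<in> U\<close>] this]
  have "(q s has_vector_derivative velocity_q s t) (at t within {0..1})"
    by (simp add: q_def[abs_def] velocity_q_def)
  \<comment> \<open>\<open>q s\<close> represents \<open>H s\<close> on an open set of times around
    \<open>t\<close>, so the derivative carries over even if \<open>t\<close> is \<open>c\<close> or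
    \<open>d\<close>.\<close>
  then have "((\<lambda>t. \<phi> (H s t)) has_vector_derivative velocity_q s t) (at t within {0..1})"
    using t01 ti open_interior_times H_in_U(2)[OF s]
      has_derivative_transform[of t "{0..1} \<inter> interior_times" "\<lambda>t. \<phi> (H s t)" "q s"]
      at_within_Int_open[OF t01 ti open_interior_times]
    unfolding has_vector_derivative_def by auto
  from squared_speed_chart[OF UA t01 H_in_U(1)[OF s ti] _ this] H_curve(1)[OF s] H_in_U(2)[OF s ti]
  show ?thesis by (simp add: Ck_map_into_def)
qed

lemma continuous_q: "continuous_on {c..d} (q s)" "continuous_on {c..d} (velocity_q s)"
  unfolding q_def[abs_def] velocity_q_def[abs_def]
  using continuous_coordinates(1,2)
  by (auto intro!: continuous_intros continuous_on_bump continuous_on_bump' simp: o_def)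

lemma energy_variation:
  assumes S: "Ck_function 1 A S"
  obtains C where "\<And>s. s \<in> {-e<..<e} \<Longrightarrow> reg_energy A G S lam (H s) =
    C + integral {c..d} (\<lambda>t. lagrangian lam (G (U,\<phi>)) (S \<circ> inv_into U \<phi>) (q s t) (velocity_q s t))"
proof -
  interpret L: C1_lagrangian "\<phi> ` U" "G (U,\<phi>)" "\<lambda>y. frechet_derivative (G (U,\<phi>)) (at y)"
    "S \<circ> inv_into U \<phi>" "\<lambda>y. frechet_derivative (S \<circ> inv_into U \<phi>) (at y)" lam
    by (rule chart_lagrangian[OF UA S])
  have sub: "{c..d} \<subseteq> {0..1}" using cd by auto
  \<comment> \<open>The energy of \<open>\<gamma>\<close> outside \<open>{c..d}\<close>, where
    varying \<open>s\<close> changes nothing.\<close>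
  define C where "C = 1/2 * (integral {0..1} (squared_speed A G \<gamma>) - integral {c..d} (squared_speed A G \<gamma>))
      + lam * (integral {0..1} (\<lambda>t. S (\<gamma> t)) - integral {c..d} (\<lambda>t. S (\<gamma> t)))"
  have "reg_energy A G S lam (H s) =
    C + integral {c..d} (\<lambda>t. lagrangian lam (G (U,\<phi>)) (S \<circ> inv_into U \<phi>) (q s t) (velocity_q s t))"
    if s: "s \<in> {-e<..<e}" for s
  proof -
    let ?K = "\<lambda>t. velocity_q s t \<bullet> (G (U,\<phi>) (q s t) *v velocity_q s t)"
    let ?R = "\<lambda>t. (S \<circ> inv_into U \<phi>) (q s t)"
    have img: "q s ` {c..d} \<subseteq> \<phi> ` U"
      using q_in_chart[OF s] support_interior by blast
    have K: "continuous_on {c..d} ?K"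
      by (intro continuous_on_inner continuous_on_mv continuous_q
          continuous_on_compose2[OF L.continuous_on_W(1) continuous_q(1) img])
    have R: "continuous_on {c..d} ?R"
      by (rule continuous_on_compose2[OF L.continuous_on_W(2) continuous_q(1) img])
    have kinetic: "integral {0..1} (squared_speed A G (H s)) =
        integral {0..1} (squared_speed A G \<gamma>) - integral {c..d} (squared_speed A G \<gamma>) + integral {c..d} ?K"
      by (rule integral_replace_on_subinterval[OF continuous_on_squared_speed[OF \<gamma>] K sub])
        (use squared_speed_off squared_speed_on[OF s] in auto)
    have potential: "integral {0..1} (\<lambda>t. S (H s t)) =
        integral {0..1} (\<lambda>t. S (\<gamma> t)) - integral {c..d} (\<lambda>t. S (\<gamma> t)) + integral {c..d} ?R"
    proof (rule integral_replace_on_subinterval[OF _ R sub])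
      show "continuous_on {0..1} (\<lambda>t. S (\<gamma> t))"
        by (rule continuous_on_compose2[OF continuous_on_Ck_function[OF S, of UNIV] continuous_\<gamma>]) simp
    qed (simp_all only: H_def if_True if_False o_def)
    have action: "integral {c..d} (\<lambda>t. lagrangian lam (G (U,\<phi>)) (S \<circ> inv_into U \<phi>) (q s t) (velocity_q s t))
        = 1/2 * integral {c..d} ?K + lam * integral {c..d} ?R"
      unfolding lagrangian_def using K R
      by (subst integral_add)
        (auto intro!: integrable_continuous_real continuous_intros simp del: o_apply)
    show ?thesis
      unfolding reg_energy_def C_def kinetic potential action by (simp only: algebra_simps)
  qed
  then show thesis by (rule that)
qed

lemma energy_has_derivative:
  assumes S: "Ck_function 1 A S"
  shows "((\<lambda>s. reg_energy A G S lam (H s)) has_real_derivative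
    integral {c..d} (\<lambda>t. bump c d t * C1_lagrangian.euler_lagrange
      (G (U,\<phi>)) (\<lambda>y. frechet_derivative (G (U,\<phi>)) (at y))
      (\<lambda>y. frechet_derivative (S \<circ> inv_into U \<phi>) (at y)) lam (x t) (velocity x t) (acceleration x t) w)) (at 0)"
proof -
  interpret L: C1_lagrangian "\<phi> ` U" "G (U,\<phi>)" "\<lambda>y. frechet_derivative (G (U,\<phi>)) (at y)"
    "S \<circ> inv_into U \<phi>" "\<lambda>y. frechet_derivative (S \<circ> inv_into U \<phi>) (at y)" lam
    by (rule chart_lagrangian[OF UA S])
  obtain C where C: "\<And>s. s \<in> {-e<..<e} \<Longrightarrow> reg_energy A G S lam (H s) =
    C + integral {c..d} (\<lambda>t. lagrangian lam (G (U,\<phi>)) (S \<circ> inv_into U \<phi>) (q s t) (velocity_q s t))"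
    by (rule energy_variation[OF S]) blast
  have mem: "t \<in> {0..1}" "\<gamma> t \<in> U" if "t \<in> {c..d}" for t using that cd in_U by auto
  have sub: "{c..d} \<subseteq> {0..1}" using cd by auto
  have "((\<lambda>s. integral {c..d} (\<lambda>t.
            lagrangian lam (G (U,\<phi>)) (S \<circ> inv_into U \<phi>) (x t + (s * bump c d t) *\<^sub>R w)
              (velocity x t + (s * bump' c d t) *\<^sub>R w)))
          has_real_derivative integral {c..d} (\<lambda>t. bump c d t *
            L.euler_lagrange (x t) (velocity x t) (acceleration x t) w)) (at 0)"
  proof (rule L.action_has_derivative[OF cd(2) e_pos])
    show "(x has_vector_derivative velocity x t) (at t within {c..d})" if "t \<in> {c..d}" for t
      by (rule has_vector_derivative_within_subset[OF coordinate_derivatives(1)[OF mem[OF that]] sub])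
    show "(velocity x has_vector_derivative acceleration x t) (at t within {c..d})" if "t \<in> {c..d}" for t
      by (rule has_vector_derivative_within_subset[OF coordinate_derivatives(2)[OF mem[OF that]] sub])
    show "x t + (s * bump c d t) *\<^sub>R w \<in> \<phi> ` U" if "s \<in> {-e<..<e}" "t \<in> {c..d}" for s t
      using in_chart[OF that] by simp
  qed (use cd in \<open>auto intro: continuous_coordinates continuous_on_bump' bump_eq_0
      has_field_derivative_at_within[OF DERIV_bump]\<close>)
  from DERIV_add[OF DERIV_const[of C] this]
  have "((\<lambda>s. C + integral {c..d} (\<lambda>t.
            lagrangian lam (G (U,\<phi>)) (S \<circ> inv_into U \<phi>) (q s t) (velocity_q s t)))
          has_real_derivative integral {c..d} (\<lambda>t. bump c d t *
            L.euler_lagrange (x t) (velocity x t) (acceleration x t) w)) (at 0)"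
    by (simp add: q_def velocity_q_def)
  then show ?thesis
    by (rule has_field_derivative_transform_within_open[of _ _ _ "{-e<..<e}"])
      (use e_pos C in auto)
qed

text \<open>For a minimizer, \<open>s = 0\<close> is a local minimum of the energy along
  \<open>H\<close>, and its derivative exists by \<open>energy_has_derivative\<close>. In the other
  case the computed derivative is compared with \<open>0\<close> by uniqueness.\<close>

lemma critical_imp_integral_zero:
  assumes S: "Ck_function 1 A S"
    and crit: "is_arg_min (reg_energy A G S lam) (\<lambda>\<delta>. \<delta> \<in> curves A (\<gamma> 0) (\<gamma> 1)) \<gamma>
           \<or> first_variation_vanishes A (reg_energy A G S lam) \<gamma>"
  shows "integral {c..d} (\<lambda>t. bump c d t * C1_lagrangian.euler_lagrange
      (G (U,\<phi>)) (\<lambda>y. frechet_derivative (G (U,\<phi>)) (at y))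
      (\<lambda>y. frechet_derivative (S \<circ> inv_into U \<phi>) (at y)) lam (x t) (velocity x t) (acceleration x t) w) = 0"
    (is "?I = 0")
  using crit
proof
  assume min: "is_arg_min (reg_energy A G S lam) (\<lambda>\<delta>. \<delta> \<in> curves A (\<gamma> 0) (\<gamma> 1)) \<gamma>"
  show "?I = 0"
  proof (rule DERIV_local_min[OF energy_has_derivative[OF S] e_pos], intro allI impI)
    fix s assume "\<bar>0 - s\<bar> < e"
    then have "s \<in> {-e<..<e}" by auto
    then have "H s \<in> curves A (\<gamma> 0) (\<gamma> 1)"
      using H_curve[of s] by (simp add: curves_def)
    then show "reg_energy A G S lam (H 0) \<le> reg_energy A G S lam (H s)"
      using min unfolding is_arg_min_def H_zero by (meson not_le)
  qed
next
  assume "first_variation_vanishes A (reg_energy A G S lam) \<gamma>"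
  then have "((\<lambda>s. reg_energy A G S lam (H s)) has_real_derivative 0) (at 0)"
    using variation_H unfolding first_variation_vanishes_def by blast
  then show "?I = 0" by (rule DERIV_unique[OF energy_has_derivative[OF S]])
qed

end

section \<open>The Euler-Lagrange expression in components\<close>

lemma inner_matrix_vector:
  fixes M :: "real ^ 'n ^ 'n"
  shows "v \<bullet> (M *v u) = (\<Sum>i\<in>UNIV. \<Sum>j\<in>UNIV. M $ i $ j * v $ i * u $ j)"
  by (simp add: inner_vec_def matrix_vector_mult_def sum_distrib_left mult_ac)

lemma axis_inner_matrix_vector:
  fixes M :: "real ^ 'n ^ 'n"
  shows "axis p 1 \<bullet> (M *v u) = (\<Sum>j\<in>UNIV. M $ p $ j * u $ j)"
  by (simp add: inner_axis' matrix_vector_mult_def)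

lemma matrix_inv_pos_def:
  fixes M :: "real ^ 'n ^ 'n"
  assumes "\<And>v. v \<noteq> 0 \<Longrightarrow> 0 < v \<bullet> (M *v v)"
  shows "matrix_inv M ** M = mat 1"
proof -
  have "M *v v = 0 \<Longrightarrow> v = 0" for v
    using assms[of v] by (cases "v = 0") auto
  then have "invertible M"
    by (simp add: invertible_left_inverse matrix_left_invertible_ker)
  then show ?thesis
    unfolding matrix_inv_def invertible_def by (rule someI_ex[THEN conjunct2])
qed

lemma solve_pos_def:
  fixes M :: "real ^ 'n ^ 'n"
  assumes "\<And>v. v \<noteq> 0 \<Longrightarrow> 0 < v \<bullet> (M *v v)" "\<And>p. axis p 1 \<bullet> (M *v a) = r p"
  shows "a $ k = (\<Sum>p\<in>UNIV. matrix_inv M $ k $ p * r p)"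
proof -
  have "a = matrix_inv M *v (M *v a)"
    using matrix_inv_pos_def[OF assms(1)] by (simp add: matrix_vector_mul_assoc)
  then have "a $ k = (matrix_inv M *v (M *v a)) $ k" by (rule arg_cong)
  also have "\<dots> = (\<Sum>p\<in>UNIV. matrix_inv M $ k $ p * (M *v a) $ p)"
    by (simp add: matrix_vector_mult_def)
  finally show ?thesis
    using assms(2) by (simp add: inner_axis')
qed

text \<open>Contracted with the symmetric product of velocity components, the first two terms of the
  Christoffel symbol contribute equally, which absorbs the factor \<open>1/2\<close> for them and
  leaves it on the third.\<close>

lemma christoffel_quadratic:
  fixes g :: "real ^ 'n \<Rightarrow> real ^ 'n ^ 'n" and x v :: "real ^ 'n"
  defines "D \<equiv> \<lambda>i p j. partial i (\<lambda>y. g y $ p $ j) x"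
  shows "(\<Sum>i\<in>UNIV. \<Sum>j\<in>UNIV. christoffel g x k i j * v $ i * v $ j) =
    (\<Sum>p\<in>UNIV. matrix_inv (g x) $ k $ p *
      ((\<Sum>i\<in>UNIV. \<Sum>j\<in>UNIV. D i p j * v $ i * v $ j)
        - 1/2 * (\<Sum>i\<in>UNIV. \<Sum>j\<in>UNIV. D p i j * v $ i * v $ j)))"
proof -
  have "(\<Sum>i\<in>UNIV. \<Sum>j\<in>UNIV. christoffel g x k i j * v $ i * v $ j) =
    (\<Sum>i\<in>UNIV. \<Sum>j\<in>UNIV. \<Sum>p\<in>UNIV. matrix_inv (g x) $ k $ p *
      (1/2 * (D i p j + D j p i - D p i j) * v $ i * v $ j))"
    unfolding christoffel_def D_def by (simp add: sum_distrib_left sum_distrib_right mult_ac)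
  also have "\<dots> = (\<Sum>p\<in>UNIV. matrix_inv (g x) $ k $ p *
      (\<Sum>i\<in>UNIV. \<Sum>j\<in>UNIV. 1/2 * (D i p j + D j p i - D p i j) * v $ i * v $ j))"
  proof -
    have swap: "(\<Sum>i\<in>UNIV. \<Sum>j\<in>UNIV. \<Sum>p\<in>UNIV. f i j p) = (\<Sum>p\<in>UNIV. \<Sum>i\<in>UNIV. \<Sum>j\<in>UNIV. f i j p)"
      for f :: "'n \<Rightarrow> 'n \<Rightarrow> 'n \<Rightarrow> real"
    proof -
      have "(\<Sum>i\<in>UNIV. \<Sum>j\<in>UNIV. \<Sum>p\<in>UNIV. f i j p) = (\<Sum>i\<in>UNIV. \<Sum>p\<in>UNIV. \<Sum>j\<in>UNIV. f i j p)"
        by (intro sum.cong refl sum.swap)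
      also have "\<dots> = (\<Sum>p\<in>UNIV. \<Sum>i\<in>UNIV. \<Sum>j\<in>UNIV. f i j p)" by (rule sum.swap)
      finally show ?thesis .
    qed
    show ?thesis unfolding sum_distrib_left by (rule swap)
  qed
  moreover have "(\<Sum>i\<in>UNIV. \<Sum>j\<in>UNIV. 1/2 * (D i p j + D j p i - D p i j) * v $ i * v $ j) =
      (\<Sum>i\<in>UNIV. \<Sum>j\<in>UNIV. D i p j * v $ i * v $ j)
        - 1/2 * (\<Sum>i\<in>UNIV. \<Sum>j\<in>UNIV. D p i j * v $ i * v $ j)" for p
  proof -
    have "(\<Sum>i\<in>UNIV. \<Sum>j\<in>UNIV. D j p i * v $ i * v $ j) = (\<Sum>i\<in>UNIV. \<Sum>j\<in>UNIV. D i p j * v $ i * v $ j)"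
      by (subst sum.swap) (simp add: mult_ac)
    then show ?thesis
      by (simp add: algebra_simps sum.distrib sum_subtractf flip: sum_divide_distrib add_divide_distrib)
  qed
  ultimately show ?thesis by (simp only:)
qed

text \<open>Testing along \<open>axis p 1\<close> yields the \<open>p\<close>-th equation with
  lowered index. The acceleration is kept as the matrix product \<open>g y *v a\<close>, ready for
  inversion of the metric.\<close>

lemma (in C1_lagrangian) euler_lagrange_axis:
  assumes "y \<in> W"
  shows "euler_lagrange y v a (axis p 1) =
    1/2 * (\<Sum>i\<in>UNIV. \<Sum>j\<in>UNIV. partial p (\<lambda>y. g y $ i $ j) y * v $ i * v $ j)
    + lam * partial p \<sigma> y
    - (\<Sum>i\<in>UNIV. \<Sum>j\<in>UNIV. partial i (\<lambda>y. g y $ p $ j) y * v $ i * v $ j)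
    - axis p 1 \<bullet> (g y *v a)"
proof -
  have partial_g: "partial r (\<lambda>y. g y $ i $ j) y = g' y (axis r 1) $ i $ j" for r i j
    by (rule partial_eq_derivative)
      (intro bounded_linear.has_derivative[OF bounded_linear_vec_nth] g' assms)
  have "g' y v = (\<Sum>i\<in>UNIV. v $ i *\<^sub>R g' y (axis i 1))"
  proof -
    have "g' y v = g' y (\<Sum>i\<in>UNIV. v $ i *\<^sub>R axis i 1)"
      by (simp add: basis_expansion flip: scalar_mult_eq_scaleR)
    then show ?thesis
      using has_derivative_linear[OF g'[OF assms]] by (simp add: linear_sum linear_scale)
  qed
  then have "axis p 1 \<bullet> (g' y v *v v) =
      (\<Sum>j\<in>UNIV. \<Sum>i\<in>UNIV. g' y (axis i 1) $ p $ j * v $ i * v $ j)"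
    by (simp add: axis_inner_matrix_vector sum_distrib_left sum_distrib_right mult_ac)
  also have "\<dots> = (\<Sum>i\<in>UNIV. \<Sum>j\<in>UNIV. partial i (\<lambda>y. g y $ p $ j) y * v $ i * v $ j)"
    unfolding partial_g by (rule sum.swap)
  finally show ?thesis
    unfolding euler_lagrange_def inner_matrix_vector[of v "g' y (axis p 1)"]
      partial_eq_derivative[OF \<sigma>'[OF assms]] partial_g by simp
qed

section \<open>Pointwise Euler-Lagrange equation and geodesic form\<close>

context riemannian_atlas
begin

lemma critical_imp_euler_lagrange:
  assumes S: "Ck_function 1 A S" and \<gamma>: "Ck_map_into 2 A {0..1} \<gamma>" and UA: "(U, \<phi>) \<in> A"
    and crit: "is_arg_min (reg_energy A G S lam) (\<lambda>\<delta>. \<delta> \<in> curves A (\<gamma> 0) (\<gamma> 1)) \<gamma>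
           \<or> first_variation_vanishes A (reg_energy A G S lam) \<gamma>"
    and t: "t \<in> {0..1}" "\<gamma> t \<in> U"
  shows "C1_lagrangian.euler_lagrange
      (G (U,\<phi>)) (\<lambda>y. frechet_derivative (G (U,\<phi>)) (at y))
      (\<lambda>y. frechet_derivative (S \<circ> inv_into U \<phi>) (at y)) lam
      (\<phi> (\<gamma> t)) (velocity (\<phi> \<circ> \<gamma>) t) (acceleration (\<phi> \<circ> \<gamma>) t) w = 0"
proof -
  interpret L: C1_lagrangian "\<phi> ` U" "G (U,\<phi>)" "\<lambda>y. frechet_derivative (G (U,\<phi>)) (at y)"
    "S \<circ> inv_into U \<phi>" "\<lambda>y. frechet_derivative (S \<circ> inv_into U \<phi>) (at y)" lam
    by (rule chart_lagrangian[OF UA S])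
  define D where "D = {t \<in> {0..1}. \<gamma> t \<in> U}"
  obtain N where N: "open N" "D = {0..1} \<inter> N" and C2: "Ck_on 2 D (\<phi> \<circ> \<gamma>)"
    using curve_in_chart[OF UA \<gamma>] unfolding D_def by blast
  have img: "(\<phi> \<circ> \<gamma>) ` D \<subseteq> \<phi> ` U" by (auto simp: D_def)
  define P where "P t = L.euler_lagrange ((\<phi> \<circ> \<gamma>) t) (velocity (\<phi> \<circ> \<gamma>) t) (acceleration (\<phi> \<circ> \<gamma>) t) w" for t
  have "P t = 0"
  proof (rule fundamental_lemma_bump[of D P N t, OF _ N(2,1)])
    show "continuous_on D P"
      unfolding P_def[abs_def]
      by (rule L.continuous_on_euler_lagrange[OF Ck_on_imp_continuous_on[OF C2] C2_curve(3,4)[OF C2 N(2,1)] img])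
    show "t \<in> D" using t by (simp add: D_def)
    fix c d :: real assume cd: "0 < c" "c < d" "d < 1" and sub: "{c..d} \<subseteq> D"
    have "compact ((\<phi> \<circ> \<gamma>) ` {c..d})"
      by (intro compact_continuous_image continuous_on_subset[OF Ck_on_imp_continuous_on[OF C2] sub]) simp
    moreover have "(\<phi> \<circ> \<gamma>) ` {c..d} \<subseteq> \<phi> ` U" using img sub by blast
    ultimately obtain r where r: "r > 0" "(\<Union>y\<in>(\<phi> \<circ> \<gamma>) ` {c..d}. ball y r) \<subseteq> \<phi> ` U"
      using compact_subset_open_imp_ball_epsilon_subset[OF _ chart(2)[OF UA]] by blast
    have "bounded (bump c d ` {c..d})"
      by (intro compact_imp_bounded compact_continuous_image continuous_on_bump) simp
    then obtain B where B: "B > 0" "\<And>t. t \<in> {c..d} \<Longrightarrow> \<bar>bump c d t\<bar> \<le> B"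
      by (auto simp: bounded_pos)
    \<comment> \<open>\<open>r\<close> is a safety radius of the compact coordinate arc inside the
      chart and \<open>B\<close> bounds the bump, so the displacement stays below \<open>r\<close>
      for \<open>\<bar>s\<bar> < e\<close>. The summand \<open>1\<close> keeps the denominator
      positive when \<open>w = 0\<close>.\<close>
    define e where "e = r / (B * (norm w + 1))"
    have Bw: "0 < B * (norm w + 1)" using B by (simp add: add_nonneg_pos)
    then have e: "e > 0" using r by (simp add: e_def)
    have "\<phi> (\<gamma> t) + (s * bump c d t) *\<^sub>R w \<in> \<phi> ` U" if s: "s \<in> {-e<..<e}" and t: "t \<in> {c..d}" for s t
    proof -
      have "norm ((s * bump c d t) *\<^sub>R w) = \<bar>s\<bar> * (\<bar>bump c d t\<bar> * norm w)" by (simp add: abs_mult)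
      also have "\<dots> \<le> \<bar>s\<bar> * (B * (norm w + 1))"
        using B t by (intro mult_left_mono mult_mono) auto
      also have "\<dots> < e * (B * (norm w + 1))"
        using s Bw by (intro mult_strict_right_mono) auto
      also have "\<dots> = r" using Bw less_irrefl unfolding e_def by (metis nonzero_eq_divide_eq)
      finally have "\<phi> (\<gamma> t) + (s * bump c d t) *\<^sub>R w \<in> ball ((\<phi> \<circ> \<gamma>) t) r"
        by (simp add: dist_norm)
      with r(2) t show ?thesis by blast
    qed
    then interpret V: bump_variation A G U \<phi> \<gamma> c d e w
      using UA \<gamma> cd sub e by unfold_locales (auto simp: D_def)
    show "integral {c..d} (\<lambda>t. bump c d t * P t) = 0"
      unfolding P_def by (rule V.critical_imp_integral_zero[OF S crit])
  qed
  then show ?thesis by (simp add: P_def)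
qed

end

theorem proposition3p3:
  fixes A :: "('m::{t2_space,second_countable_topology}, 'n::finite) chart set"
    and G :: "('m, 'n) chart \<Rightarrow> real ^ 'n \<Rightarrow> real ^ 'n ^ 'n"
    and S :: "'m \<Rightarrow> real" and lam :: real
    and a b :: 'm and \<gamma> :: "real \<Rightarrow> 'm"
    and U :: "'m set" and \<phi> :: "'m \<Rightarrow> real ^ 'n" and t :: real and k :: 'n
  assumes "smooth_atlas A" and "riemannian_metric A G"
    and "Ck_function 1 A S" and "bdd_below (range S)"
    and "lam > 0"
    and "\<gamma> \<in> curves A a b"
    and "is_arg_min (reg_energy A G S lam) (\<lambda>\<delta>. \<delta> \<in> curves A a b) \<gamma>
           \<or> first_variation_vanishes A (reg_energy A G S lam) \<gamma>"
    and "(U, \<phi>) \<in> A" and "t \<in> {0..1}" and "\<gamma> t \<in> U"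
  shows "acceleration (\<phi> \<circ> \<gamma>) t $ k
      + (\<Sum>i\<in>UNIV. \<Sum>j\<in>UNIV. christoffel (G (U,\<phi>)) (\<phi> (\<gamma> t)) k i j
           * velocity (\<phi> \<circ> \<gamma>) t $ i * velocity (\<phi> \<circ> \<gamma>) t $ j)
    = lam * (\<Sum>p\<in>UNIV. matrix_inv (G (U,\<phi>) (\<phi> (\<gamma> t))) $ k $ p
           * partial p (S \<circ> inv_into U \<phi>) (\<phi> (\<gamma> t)))"
proof -
  interpret riemannian_atlas A G using assms(1,2) by unfold_locales
  interpret L: C1_lagrangian "\<phi> ` U" "G (U,\<phi>)" "\<lambda>y. frechet_derivative (G (U,\<phi>)) (at y)"
    "S \<circ> inv_into U \<phi>" "\<lambda>y. frechet_derivative (S \<circ> inv_into U \<phi>) (at y)" lam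
    by (rule chart_lagrangian[OF assms(8,3)])
  have \<gamma>: "Ck_map_into 2 A {0..1} \<gamma>" "\<gamma> 0 = a" "\<gamma> 1 = b"
    using assms(6) by (auto simp: curves_def)
  define g where "g = G (U,\<phi>)"
  define y where "y = \<phi> (\<gamma> t)"
  define v where "v = velocity (\<phi> \<circ> \<gamma>) t"
  define q where "q = acceleration (\<phi> \<circ> \<gamma>) t"
  \<comment> \<open>The Christoffel symbols of the first kind contracted with the velocity twice;
    the inverse metric raises the index \<open>p\<close> below.\<close>
  define K where "K p = (\<Sum>i\<in>UNIV. \<Sum>j\<in>UNIV. partial i (\<lambda>y. g y $ p $ j) y * v $ i * v $ j)
    - 1/2 * (\<Sum>i\<in>UNIV. \<Sum>j\<in>UNIV. partial p (\<lambda>y. g y $ i $ j) y * v $ i * v $ j)" for p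
  have y: "y \<in> \<phi> ` U" using assms(10) by (simp add: y_def)
  \<comment> \<open>The factor \<open>1/2\<close> of the kinetic term has been consumed by
    differentiating a quadratic form in the velocity, so the coefficient of the partial derivative
    of \<open>S\<close> is the full \<open>lam\<close>.\<close>
  have "axis p 1 \<bullet> (g y *v q) = lam * partial p (S \<circ> inv_into U \<phi>) y - K p" for p
    using critical_imp_euler_lagrange[OF assms(3) \<gamma>(1) assms(8) _ assms(9,10), of lam "axis p 1"]
      assms(7) L.euler_lagrange_axis[OF y, of v q p] \<gamma>(2,3)
    by (simp add: K_def flip: g_def y_def v_def q_def)
  then have "q $ k = (\<Sum>p\<in>UNIV. matrix_inv (g y) $ k $ p * (lam * partial p (S \<circ> inv_into U \<phi>) y - K p))"
    by (rule solve_pos_def[rotated]) (use chart_pos_def[OF assms(8)] y in \<open>simp add: g_def\<close>)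
  moreover have "(\<Sum>i\<in>UNIV. \<Sum>j\<in>UNIV. christoffel g y k i j * v $ i * v $ j)
      = (\<Sum>p\<in>UNIV. matrix_inv (g y) $ k $ p * K p)"
    unfolding K_def by (rule christoffel_quadratic)
  ultimately show ?thesis
    unfolding g_def[symmetric] y_def[symmetric] v_def[symmetric] q_def[symmetric]
    by (simp add: right_diff_distrib sum_subtractf sum_distrib_left mult_ac)
qed

end
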